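(* Let $Q_0>0$, $0<\epsilon_0\le Q_0/3$ and $Q_1\ge Q_2\ge 0$. For costs $(c_1,c_2)$ with $c_1,c_2\ge 0$, consider the Sellers' Information Disclosure Game with parameters $(Q_1,Q_2,c_1,c_2,Q_0,\epsilon_0)$, and call a behavior pattern (I, II, III or IV) achievable for $(Q_1,Q_2)$ if there are costs $c_1,c_2\ge0$ under which it occurs. There exist four equilibrium structures, which are decided by $(Q_1,Q_2)$: (a) "All-Achievable": all four patterns I, II, III, IV are achievable. This happens when $(Q_1,Q_2)$ is in one of the following three cases: 1) $Q_1\in[Q_0-3\epsilon_0,\;Q_0+(6-3\sqrt5)\epsilon_0)$ and $Q_2\in[Q_0-3\epsilon_0,\;Q_1]$; 2) $Q_1\in[Q_0+(6-3\sqrt5)\epsilon_0,\;Q_0+3\epsilon_0)$ and $Q_2\in\left[Q_0-6\epsilon_0+\sqrt{54\epsilon_0^2-(Q_1-Q_0-6\epsilon_0)^2},\;Q_1\right]$; 3) $Q_1\in[Q_0+3\epsilon_0,+\infty)$ and $Q_2\in[Q_0-6\epsilon_0+3\sqrt5\,\epsilon_0,\;Q_1]$. (b) "No-Mixed-Pattern": Patterns I, III and IV are achievable, but Pattern II is not achievable. This happens when $(Q_1,Q_2)$ is in one of the following two cases: 1) $Q_1\in[Q_0+(6-3\sqrt5)\epsilon_0,\;Q_0+3\epsilon_0)$ and $Q_2\in\left[Q_0-3\epsilon_0,\;Q_0-6\epsilon_0+\sqrt{54\epsilon_0^2-(Q_1-Q_0-6\epsilon_0)^2}\right)$; 2) $Q_1\in[Q_0+3\epsilon_0,+\infty)$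 and $Q_2\in[Q_0-3\epsilon_0,\;Q_0-6\epsilon_0+3\sqrt5\,\epsilon_0)$. (c) "L-NeverDisclosure": only Patterns I and IV are achievable (seller 2, who has the lower quality, never discloses information, and whether seller 1 discloses depends on his cost). This happens when $0\le Q_2<Q_0-3\epsilon_0<Q_1$. (d) "None-Disclosure": only Pattern IV is achievable (neither seller discloses information). This happens when $0\le Q_2<Q_1<Q_0-3\epsilon_0$.
   Context: Model. Two sellers $i\in\{1,2\}$ with true qualities $Q_1\ge Q_2\ge0$ and marginal privacy costs $c_i\ge 0$ compete for one buyer. Seller $i$ chooses a disclosure level $\alpha_i\in[0,1]$ and a price $p_i\in[0,\infty)$; write $\boldsymbol\alpha=(\alpha_1,\alpha_2)$, $\boldsymbol p=(p_1,p_2)$. The buyer has an average prior belief $Q_0$ on quality and a random estimation bias $\epsilon\sim U(-\epsilon_0,\epsilon_0)$, unknown to the sellers, with $0<\epsilon_0\le Q_0/3$. Choosing seller $i$ gives the buyer payoff $U_i=\alpha_iQ_i+(1-\alpha_i)(Q_0+\epsilon)-p_i$; she picks the seller with the larger payoff, ties being broken with probability $1/2$ each. Let $Pr_i(\boldsymbol\alpha,\boldsymbol p,\epsilon)\in\{0,\tfrac12,1\}$ be the resulting winning probability of seller $i$. Seller $i$'s expected profit is $E[W_i(\boldsymbol\alpha,\boldsymbol p)]=E_\epsilon[p_i\,Pr_i(\boldsymbol\alpha,\boldsymbol p,\epsilon)-c_i\alpha_i]$. Stage I-b (Sellers' Pricing Game): for given $\boldsymbol\alpha$, sellers simultaneously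 choose prices, each maximizing expected profit; $(p_1^*,p_2^* )$ denotes a pure Nash equilibrium. With $\psi=\alpha_1(Q_1-Q_0)-\alpha_2(Q_2-Q_0)$ and $\xi=\epsilon_0|\alpha_1-\alpha_2|$: if $\alpha_1\ne\alpha_2$, then $(p_1^*,p_2^* )$ equals $(0,-\psi-\xi)$ if $\psi\le-3\xi$, $\left(\frac{3\xi+\psi}{3},\frac{3\xi-\psi}{3}\right)$ if $-3\xi<\psi<3\xi$, and $(\psi-\xi,0)$ if $\psi\ge3\xi$; if $\alpha_1=\alpha_2=0$, then $p_1^*=p_2^*=0$; if $\alpha_1=\alpha_2>0$, there is taken to be no pure-strategy pricing equilibrium. Stage I-a (Sellers' Information Disclosure Game): sellers simultaneously choose $\alpha_i\in[0,1]$, the payoff $E[W_i(\alpha_1,\alpha_2)]$ being the expected profit at the Stage I-b equilibrium prices. An equilibrium is a profile $(\alpha_1^*,\alpha_2^* )$ with $E[W_i(\alpha_i^*,\alpha_j^* )]\ge E[W_i(\alpha_i,\alpha_j^* )]$ for all $\alpha_i\in[0,1]$ and each $i$ ($j\ne i$). Profiles with $\alpha_1=\alpha_2>0$ have no pricing equilibrium and are not equilibria; the inequality is required for deviations at which the payoff is defined. Behavior patterns: Pattern I: there is a unique equilibrium, $(\alpha_1^*,\alpha_2^* )=(1,0)$. Pattern II: there are two co-existing equilibria, $(1,0)$ and $(0,1)$. Pattern III: there is a unique equilibrium, $(0,1)$. Pattern IV: there is a unique equilibrium, $(0,0)$.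
   Formalization: (a),(b) omit points with Q2=Q0-3ε0, and (a2),(a3) omit the lower end of the Q2-interval, where the claim fails: Pattern III (resp. II) is not achievable. The true structure there is stated: {I,IV} (only IV if Q1=Q0-3ε0 too), resp. {I,III,IV}. *)

theory Defs
  imports "HOL-Analysis.Analysis"
begin

datatype seller = Seller1 | Seller2

fun rival :: "seller \<Rightarrow> seller" where
  "rival Seller1 = Seller2"
| "rival Seller2 = Seller1"

text \<open>Qualities, costs, disclosure levels and prices are all functions of the seller;
  \<open>profile x y\<close> is the pair $(x, y)$, and a unilateral deviation of seller \<open>i\<close> is a
  function update at \<open>i\<close>.\<close>

fun profile :: "real \<Rightarrow> real \<Rightarrow> seller \<Rightarrow> real" where
  "profile x y Seller1 = x"
| "profile x y Seller2 = y"

definition buyer_payoff ::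
  "(seller \<Rightarrow> real) \<Rightarrow> real \<Rightarrow> (seller \<Rightarrow> real) \<Rightarrow> (seller \<Rightarrow> real) \<Rightarrow> real \<Rightarrow> seller \<Rightarrow> real" where
  "buyer_payoff Q Q0 \<alpha> p \<epsilon> i = \<alpha> i * Q i + (1 - \<alpha> i) * (Q0 + \<epsilon>) - p i"

definition win_prob ::
  "(seller \<Rightarrow> real) \<Rightarrow> real \<Rightarrow> (seller \<Rightarrow> real) \<Rightarrow> (seller \<Rightarrow> real) \<Rightarrow> real \<Rightarrow> seller \<Rightarrow> real" where
  "win_prob Q Q0 \<alpha> p \<epsilon> i =
     (if buyer_payoff Q Q0 \<alpha> p \<epsilon> i > buyer_payoff Q Q0 \<alpha> p \<epsilon> (rival i) then 1
      else if buyer_payoff Q Q0 \<alpha> p \<epsilon> i = buyer_payoff Q Q0 \<alpha> p \<epsilon> (rival i) then 1 / 2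
      else 0)"

definition expected_profit ::
  "(seller \<Rightarrow> real) \<Rightarrow> (seller \<Rightarrow> real) \<Rightarrow> real \<Rightarrow> real \<Rightarrow>
   (seller \<Rightarrow> real) \<Rightarrow> (seller \<Rightarrow> real) \<Rightarrow> seller \<Rightarrow> real" where
  "expected_profit Q c Q0 \<epsilon>0 \<alpha> p i =
     (LINT \<epsilon>|uniform_measure lborel {-\<epsilon>0<..<\<epsilon>0}. p i * win_prob Q Q0 \<alpha> p \<epsilon> i - c i * \<alpha> i)"

definition price_nash ::
  "(seller \<Rightarrow> real) \<Rightarrow> (seller \<Rightarrow> real) \<Rightarrow> real \<Rightarrow> real \<Rightarrow>
   (seller \<Rightarrow> real) \<Rightarrow> (seller \<Rightarrow> real) \<Rightarrow> bool" where
  "price_nash Q c Q0 \<epsilon>0 \<alpha> p \<longleftrightarrow>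
     (\<forall>i. 0 \<le> p i) \<and>
     (\<forall>i. \<forall>q\<ge>0. expected_profit Q c Q0 \<epsilon>0 \<alpha> (p(i := q)) i \<le> expected_profit Q c Q0 \<epsilon>0 \<alpha> p i)"

text \<open>Equal positive disclosure levels count, by convention, as having no pricing equilibrium.
  The convention has content only for equal qualities, where zero prices would form a
  Nash equilibrium; for distinct qualities there is none anyway.\<close>

definition pricing_equilibrium ::
  "(seller \<Rightarrow> real) \<Rightarrow> (seller \<Rightarrow> real) \<Rightarrow> real \<Rightarrow> real \<Rightarrow>
   (seller \<Rightarrow> real) \<Rightarrow> (seller \<Rightarrow> real) \<Rightarrow> bool" where
  "pricing_equilibrium Q c Q0 \<epsilon>0 \<alpha> p \<longleftrightarrow>
     \<not> (\<alpha> Seller1 = \<alpha> Seller2 \<and> \<alpha> Seller1 > 0) \<and> price_nash Q c Q0 \<epsilon>0 \<alpha> p"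

definition priceable ::
  "(seller \<Rightarrow> real) \<Rightarrow> (seller \<Rightarrow> real) \<Rightarrow> real \<Rightarrow> real \<Rightarrow> (seller \<Rightarrow> real) \<Rightarrow> bool" where
  "priceable Q c Q0 \<epsilon>0 \<alpha> \<longleftrightarrow> (\<exists>!p. pricing_equilibrium Q c Q0 \<epsilon>0 \<alpha> p)"

text \<open>Only meaningful at profiles that are \<open>priceable\<close>. With levels in $[0,1]$ and
  $\epsilon_0 > 0$ these are exactly the profiles with distinct levels and $(0,0)$. With
  $\psi = \alpha_1 (Q_1 - Q_0) - \alpha_2 (Q_2 - Q_0)$ and
  $\xi = \epsilon_0 |\alpha_1 - \alpha_2|$, the equilibrium prices for distinct levels are
  $(0, -\psi-\xi)$ if $\psi \le -3\xi$, $((3\xi+\psi)/3, (3\xi-\psi)/3)$ if $|\psi| < 3\xi$,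
  and $(\psi-\xi, 0)$ if $\psi \ge 3\xi$; at $(0,0)$ they are zero.\<close>

definition disclosure_payoff ::
  "(seller \<Rightarrow> real) \<Rightarrow> (seller \<Rightarrow> real) \<Rightarrow> real \<Rightarrow> real \<Rightarrow> (seller \<Rightarrow> real) \<Rightarrow> seller \<Rightarrow> real" where
  "disclosure_payoff Q c Q0 \<epsilon>0 \<alpha> =
     expected_profit Q c Q0 \<epsilon>0 \<alpha> (THE p. pricing_equilibrium Q c Q0 \<epsilon>0 \<alpha> p)"

definition disclosure_equilibrium ::
  "(seller \<Rightarrow> real) \<Rightarrow> (seller \<Rightarrow> real) \<Rightarrow> real \<Rightarrow> real \<Rightarrow> (seller \<Rightarrow> real) \<Rightarrow> bool" where
  "disclosure_equilibrium Q c Q0 \<epsilon>0 \<alpha> \<longleftrightarrow>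
     (\<forall>i. \<alpha> i \<in> {0..1}) \<and> priceable Q c Q0 \<epsilon>0 \<alpha> \<and>
     (\<forall>i. \<forall>a\<in>{0..1}. priceable Q c Q0 \<epsilon>0 (\<alpha>(i := a)) \<longrightarrow>
        disclosure_payoff Q c Q0 \<epsilon>0 (\<alpha>(i := a)) i \<le> disclosure_payoff Q c Q0 \<epsilon>0 \<alpha> i)"

datatype pattern = Pattern_I | Pattern_II | Pattern_III | Pattern_IV

fun pattern_equilibria :: "pattern \<Rightarrow> (seller \<Rightarrow> real) set" where
  "pattern_equilibria Pattern_I = {profile 1 0}"
| "pattern_equilibria Pattern_II = {profile 1 0, profile 0 1}"
| "pattern_equilibria Pattern_III = {profile 0 1}"
| "pattern_equilibria Pattern_IV = {profile 0 0}"

definition pattern_occurs ::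
  "(seller \<Rightarrow> real) \<Rightarrow> (seller \<Rightarrow> real) \<Rightarrow> real \<Rightarrow> real \<Rightarrow> pattern \<Rightarrow> bool" where
  "pattern_occurs Q c Q0 \<epsilon>0 P \<longleftrightarrow>
     {\<alpha>. disclosure_equilibrium Q c Q0 \<epsilon>0 \<alpha>} = pattern_equilibria P"

definition achievable_patterns :: "real \<Rightarrow> real \<Rightarrow> real \<Rightarrow> real \<Rightarrow> pattern set" where
  "achievable_patterns Q0 \<epsilon>0 Q1 Q2 =
     {P. \<exists>c1\<ge>0. \<exists>c2\<ge>0. pattern_occurs (profile Q1 Q2) (profile c1 c2) Q0 \<epsilon>0 P}"

definition mixed_threshold :: "real \<Rightarrow> real \<Rightarrow> real \<Rightarrow> real" where
  "mixed_threshold Q0 \<epsilon>0 Q1 =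
     (if Q1 < Q0 + 3 * \<epsilon>0 then Q0 - 6 * \<epsilon>0 + sqrt (54 * \<epsilon>0\<^sup>2 - (Q1 - Q0 - 6 * \<epsilon>0)\<^sup>2)
      else Q0 - 6 * \<epsilon>0 + 3 * sqrt 5 * \<epsilon>0)"

text \<open>\<open>all_region\<close> and \<open>no_mixed_region\<close> contain their lower boundaries.
  \<open>disclosure_boundary\<close> and \<open>mixed_boundary\<close> collect the boundary points at which a
  pattern can be sustained at best by a cost that makes a seller indifferent. There the
  equilibria required by the pattern coexist with a continuum of others, so the pattern is
  not achievable.\<close>

definition all_region :: "real \<Rightarrow> real \<Rightarrow> (real \<times> real) set" where
  "all_region Q0 \<epsilon>0 =
     {(Q1, Q2). Q1 \<in> {Q0 - 3 * \<epsilon>0 ..< Q0 + (6 - 3 * sqrt 5) * \<epsilon>0} \<and> Q2 \<in> {Q0 - 3 * \<epsilon>0 .. Q1}} \<union>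
     {(Q1, Q2). Q1 \<in> {Q0 + (6 - 3 * sqrt 5) * \<epsilon>0 ..< Q0 + 3 * \<epsilon>0} \<and>
                Q2 \<in> {mixed_threshold Q0 \<epsilon>0 Q1 .. Q1}} \<union>
     {(Q1, Q2). Q1 \<in> {Q0 + 3 * \<epsilon>0 ..} \<and> Q2 \<in> {mixed_threshold Q0 \<epsilon>0 Q1 .. Q1}}"

definition no_mixed_region :: "real \<Rightarrow> real \<Rightarrow> (real \<times> real) set" where
  "no_mixed_region Q0 \<epsilon>0 =
     {(Q1, Q2). Q1 \<in> {Q0 + (6 - 3 * sqrt 5) * \<epsilon>0 ..< Q0 + 3 * \<epsilon>0} \<and>
                Q2 \<in> {Q0 - 3 * \<epsilon>0 ..< mixed_threshold Q0 \<epsilon>0 Q1}} \<union>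
     {(Q1, Q2). Q1 \<in> {Q0 + 3 * \<epsilon>0 ..} \<and> Q2 \<in> {Q0 - 3 * \<epsilon>0 ..< mixed_threshold Q0 \<epsilon>0 Q1}}"

definition disclosure_boundary :: "real \<Rightarrow> real \<Rightarrow> (real \<times> real) set" where
  "disclosure_boundary Q0 \<epsilon>0 = {(Q1, Q2). Q2 = Q0 - 3 * \<epsilon>0}"

definition mixed_boundary :: "real \<Rightarrow> real \<Rightarrow> (real \<times> real) set" where
  "mixed_boundary Q0 \<epsilon>0 =
     {(Q1, Q2). Q0 + (6 - 3 * sqrt 5) * \<epsilon>0 < Q1 \<and> Q2 = mixed_threshold Q0 \<epsilon>0 Q1}"

end

(*
  At the equilibrium prices a seller earns revenue xi psi, where psi is his quality gap and xi
  the spread of the noise. This function is positively homogeneous, and in psi it is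
  nondecreasing and 1-Lipschitz. Hence his payoff as a function of his own level lies below
  the chord from level 0 to the rival's level, and in equilibrium only level 0 and full
  disclosure matter. Writing A = Q1 - Q0, B = Q2 - Q0 and rho = revenue e, full disclosure by
  seller 1 alone is an equilibrium iff c1 <= rho A and B - A - rho (-A) <= c2, and
  symmetrically for seller 2. Both coexist, robustly, iff A - B - rho (-B) < rho A, which
  describes the region above mixed_threshold. If a cost makes a disclosing seller indifferent,
  then (outside a corner case that does not arise here) partial disclosure at some level
  strictly between 0 and 1 is an equilibrium too, so the pattern does not occur.
*)

theory Submission
  imports Defs "HOL-Probability.Probability_Measure"
begin

section \<open>The pricing game\<close>

text \<open>Probability that \<open>x + U\<close> is positive for \<open>U\<close> uniform on the
  interval from \<open>- \<xi>\<close> to \<open>\<xi>\<close>.\<close>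

definition win_share :: "real \<Rightarrow> real \<Rightarrow> real" where
  "win_share \<xi> x = min 1 (max 0 ((x + \<xi>) / (2 * \<xi>)))"

text \<open>Since \<open>k\<close> is nonzero, ties form a null set, so the integral is the relative
  length of the part of the noise interval where the seller wins. By symmetry of the interval only
  \<open>\<bar>k\<bar>\<close> matters.\<close>

lemma integral_win_uniform:
  fixes e k x :: real
  assumes e: "0 < e" and k: "k \<noteq> 0"
  shows "(LINT \<epsilon>|uniform_measure lborel {-e<..<e}.
            (if 0 < x + k * \<epsilon> then 1 else if x + k * \<epsilon> = 0 then 1 / 2 else (0::real)))
         = win_share (e * \<bar>k\<bar>) x"
proof -
  let ?I = "{-e<..<e}" and ?S = "{\<epsilon>. 0 < x + k * \<epsilon>}"
  let ?M = "uniform_measure lborel ?I"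
  \<comment> \<open>The cut-off in units of the noise: the seller wins for \<epsilon> above
    \<open>- t\<close> if \<open>k\<close> is positive and below \<open>t\<close> if
    \<open>k\<close> is negative.\<close>
  define t where "t = x / \<bar>k\<bar>"
  have "(x + e * \<bar>k\<bar>) / (2 * (e * \<bar>k\<bar>)) = (t + e) / (2 * e)"
    using assms by (simp add: t_def field_simps)
  then have share: "win_share (e * \<bar>k\<bar>) x = min 1 (max 0 ((t + e) / (2 * e)))"
    by (simp only: win_share_def)
  have S: "?S \<in> sets borel" by measurable
  have "AE \<epsilon> in lborel. \<epsilon> \<noteq> - x / k"
    by (rule AE_lborel_singleton)
  then have "AE \<epsilon> in ?M. \<epsilon> \<noteq> - x / k"
    by (intro AE_uniform_measureI) auto
  then have "AE \<epsilon> in ?M. (if 0 < x + k * \<epsilon> then 1 else if x + k * \<epsilon> = 0 then 1 / 2 else 0)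
                = (indicator ?S \<epsilon> :: real)"
    by eventually_elim (use k in \<open>auto simp: field_simps indicator_def\<close>)
  then have "(LINT \<epsilon>|?M. (if 0 < x + k * \<epsilon> then 1 else if x + k * \<epsilon> = 0 then 1 / 2 else 0))
        = (LINT \<epsilon>|?M. (indicator ?S \<epsilon> :: real))"
    by (intro integral_cong_AE) (use S in measurable)
  also have "\<dots> = measure ?M ?S"
    by simp
  also have "\<dots> = measure lborel (?I \<inter> ?S) / measure lborel ?I"
    using S e by (intro measure_uniform_measure) auto
  also have "measure lborel (?I \<inter> ?S) = 2 * e * win_share (e * \<bar>k\<bar>) x"
  proof (cases "k > 0")
    case True
    then have "?I \<inter> ?S = {max (-e) (- t)<..<e}"
      by (auto simp: t_def field_simps)
    then have *: "measure lborel (?I \<inter> ?S) = max 0 (e - max (-e) (- t))"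
      by (auto simp: max_def)
    show ?thesis
      unfolding * share using e
      by (auto simp: max_def min_def field_simps split: if_splits)
  next
    case False
    then have "k < 0" using k by simp
    then have "?I \<inter> ?S = {-e<..<min e t}"
      by (auto simp: t_def field_simps)
    then have *: "measure lborel (?I \<inter> ?S) = max 0 (min e t + e)"
      by (cases "- e \<le> min e t") auto
    show ?thesis
      unfolding * share using e
      by (auto simp: max_def min_def field_simps split: if_splits)
  qed
  finally show ?thesis using e by simp
qed

section \<open>Expected profits as functions of the prices\<close>

text \<open>For \<open>Seller1\<close> this is the quantity \<psi> of the pricing game, for
  \<open>Seller2\<close> its negative.\<close>

definition quality_gap :: "(seller \<Rightarrow> real) \<Rightarrow> real \<Rightarrow> (seller \<Rightarrow> real) \<Rightarrow> seller \<Rightarrow> real" where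
  "quality_gap Q Q0 \<alpha> i = \<alpha> i * (Q i - Q0) - \<alpha> (rival i) * (Q (rival i) - Q0)"

lemma rival_rival [simp]: "rival (rival i) = i"
  by (cases i) auto

lemma rival_neq [simp]: "rival i \<noteq> i" "i \<noteq> rival i"
  by (cases i; simp)+

lemma all_seller_iff: "(\<forall>i. P i) \<longleftrightarrow> P j \<and> P (rival j)"
  by (metis rival.simps seller.exhaust)

lemma seller_fun_eq_iff: "f = g \<longleftrightarrow> f j = g j \<and> f (rival j) = g (rival j)"
  unfolding fun_eq_iff by (rule all_seller_iff)

lemma quality_gap_rival: "quality_gap Q Q0 \<alpha> (rival i) = - quality_gap Q Q0 \<alpha> i"
  by (simp add: quality_gap_def)

lemma win_prob_eq:
  "win_prob Q Q0 \<alpha> p \<epsilon> i =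
     (let x = quality_gap Q Q0 \<alpha> i - p i + p (rival i) + (\<alpha> (rival i) - \<alpha> i) * \<epsilon>
      in if 0 < x then 1 else if x = 0 then 1 / 2 else 0)"
proof -
  have "quality_gap Q Q0 \<alpha> i - p i + p (rival i) + (\<alpha> (rival i) - \<alpha> i) * \<epsilon>
      = buyer_payoff Q Q0 \<alpha> p \<epsilon> i - buyer_payoff Q Q0 \<alpha> p \<epsilon> (rival i)"
    by (simp add: buyer_payoff_def quality_gap_def algebra_simps)
  then show ?thesis
    unfolding win_prob_def Let_def by auto
qed

lemma prob_space_uniform_interval:
  "0 < (e::real) \<Longrightarrow> prob_space (uniform_measure lborel {-e<..<e})"
  by (rule prob_space_uniform_measure) auto

lemma expected_profit_eq:
  assumes e: "0 < e"
  shows "expected_profit Q c Q0 e \<alpha> p i =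
     p i * (LINT \<epsilon>|uniform_measure lborel {-e<..<e}. win_prob Q Q0 \<alpha> p \<epsilon> i) - c i * \<alpha> i"
proof -
  let ?M = "uniform_measure lborel {-e<..<e}"
  interpret prob_space ?M using e by (rule prob_space_uniform_interval)
  have "(\<lambda>\<epsilon>. win_prob Q Q0 \<alpha> p \<epsilon> i) \<in> borel_measurable ?M"
    unfolding win_prob_eq Let_def by measurable
  then have "integrable ?M (\<lambda>\<epsilon>. win_prob Q Q0 \<alpha> p \<epsilon> i)"
    by (intro integrable_const_bound[where B = 1]) (auto simp: win_prob_def)
  then show ?thesis
    unfolding expected_profit_def using prob_space by simp
qed

lemma expected_profit_distinct:
  assumes e: "0 < e" and "\<alpha> i \<noteq> \<alpha> (rival i)"
  shows "expected_profit Q c Q0 e \<alpha> p i =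
     p i * win_share (e * \<bar>\<alpha> i - \<alpha> (rival i)\<bar>) (quality_gap Q Q0 \<alpha> i - p i + p (rival i)) - c i * \<alpha> i"
  unfolding expected_profit_eq[OF e] win_prob_eq Let_def
  using assms by (subst integral_win_uniform) (auto simp: abs_minus_commute)

lemma expected_profit_equal:
  assumes e: "0 < e" and "\<alpha> (rival i) = \<alpha> i"
  shows "expected_profit Q c Q0 e \<alpha> p i =
     p i * (let x = quality_gap Q Q0 \<alpha> i - p i + p (rival i)
            in if 0 < x then 1 else if x = 0 then 1 / 2 else 0) - c i * \<alpha> i"
proof -
  interpret prob_space "uniform_measure lborel {-e<..<e}"
    using e by (rule prob_space_uniform_interval)
  show ?thesis
    unfolding expected_profit_eq[OF e] win_prob_eq Let_def using assms prob_space by simp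
qed

section \<open>Best responses and equilibrium prices\<close>

text \<open>In \<open>q\<close> the revenue is linear up to \<open>x - \<xi>\<close>, a concave
  parabola from there to \<open>x + \<xi>\<close>, and zero afterwards. The maximum is at the vertex
  \<open>(x + \<xi>) / 2\<close> or at the kink \<open>x - \<xi>\<close>, whichever is larger. If
  \<open>x + \<xi> \<le> 0\<close>, no price sells anything and all are optimal.\<close>

lemma best_response_iff:
  fixes \<xi> x p :: real
  assumes "0 < \<xi>" "0 \<le> p"
  shows "(\<forall>q\<ge>0. q * win_share \<xi> (x - q) \<le> p * win_share \<xi> (x - p)) \<longleftrightarrow>
           x + \<xi> \<le> 0 \<or> p = max ((x + \<xi>) / 2) (x - \<xi>)"
proof (cases "x + \<xi> \<le> 0")
  case True
  have "win_share \<xi> (x - q) = 0" if "0 \<le> q" for q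
    using True assms that by (simp add: win_share_def max_def divide_le_0_iff field_simps)
  then show ?thesis using True assms by simp
next
  case False
  define b where "b = max ((x + \<xi>) / 2) (x - \<xi>)"
  have b: "0 < b" using False by (simp add: b_def max_def)
  have strict: "q * win_share \<xi> (x - q) < b * win_share \<xi> (x - b)" if q: "0 \<le> q" "q \<noteq> b" for q
  proof (cases "x \<le> 3 * \<xi>")
    case True
    then have bb: "b = (x + \<xi>) / 2" by (auto simp: b_def)
    have wb: "win_share \<xi> (x - b) = b / (2 * \<xi>)"
      using True False assms by (auto simp: bb win_share_def field_simps)
    \<comment> \<open>Dropping the cap at 1 bounds the revenue by the positive part of the parabola,
      whose vertex is \<open>b\<close>.\<close>
    have "q * win_share \<xi> (x - q) \<le> max 0 (q * ((x - q + \<xi>) / (2 * \<xi>)))"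
    proof -
      have "q * win_share \<xi> (x - q) \<le> q * max 0 ((x - q + \<xi>) / (2 * \<xi>))"
        using q by (intro mult_left_mono) (auto simp: win_share_def)
      then show ?thesis using q by (auto simp: max_def split: if_splits)
    qed
    also have "\<dots> < b * b / (2 * \<xi>)"
    proof -
      have "q * (x - q + \<xi>) = b * b - (q - b)\<^sup>2" unfolding bb by (simp add: power2_eq_square field_simps)
      moreover have "0 < (q - b)\<^sup>2" using q by simp
      ultimately have "q * (x - q + \<xi>) < b * b" by simp
      then show ?thesis using assms b by (simp add: divide_strict_right_mono)
    qed
    finally show ?thesis by (simp add: wb)
  next
    case xi: False
    then have bb: "b = x - \<xi>" by (auto simp: b_def)
    have wb: "win_share \<xi> (x - b) = 1"
      using assms by (auto simp: bb win_share_def)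
    show ?thesis
    proof (cases "q < b")
      case True
      have "q * win_share \<xi> (x - q) \<le> q * 1"
        using q by (intro mult_left_mono) (auto simp: win_share_def)
      then show ?thesis using True by (simp add: wb)
    next
      case False
      then have qb: "b < q" using q by simp
      have "q * win_share \<xi> (x - q) \<le> q * max 0 ((x - q + \<xi>) / (2 * \<xi>))"
        using q by (intro mult_left_mono) (auto simp: win_share_def)
      also have "\<dots> = max 0 (q * (x - q + \<xi>) / (2 * \<xi>))"
        using q assms by (auto simp: max_def zero_le_mult_iff zero_le_divide_iff)
      also have "\<dots> < b"
      proof -
        \<comment> \<open>The second factor equals \<open>2 * \<xi> - q\<close>, which is negative
          because \<open>q > b > 2 * \<xi>\<close> in this case.\<close>
        have "q * (x - q + \<xi>) - b * (2 * \<xi>) = (q - b) * (x - q + \<xi> - b)"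
          unfolding bb by (simp add: algebra_simps)
        also have "\<dots> < 0" using qb xi assms by (intro mult_pos_neg) (auto simp: bb)
        finally show ?thesis using assms b by (simp add: field_simps)
      qed
      finally show ?thesis by (simp add: wb)
    qed
  qed
  have "(\<forall>q\<ge>0. q * win_share \<xi> (x - q) \<le> p * win_share \<xi> (x - p)) \<longleftrightarrow> p = b"
    using strict b assms by (metis less_eq_real_def not_less)
  then show ?thesis using False by (simp add: b_def)
qed

text \<open>One function gives both prices: the seller with gap \<psi> charges
  \<open>eq_price \<xi> \<psi>\<close>, the rival \<open>eq_price \<xi> (- \<psi>)\<close>. At zero
  spread and zero gap the value is 0, which fits the undisclosed profile.\<close>

definition eq_price :: "real \<Rightarrow> real \<Rightarrow> real" where
  "eq_price \<xi> \<psi> =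
     (if \<psi> \<le> - 3 * \<xi> then 0 else if \<psi> < 3 * \<xi> then (3 * \<xi> + \<psi>) / 3 else \<psi> - \<xi>)"

text \<open>Equilibrium price times winning probability; in the middle branch these are
  \<open>(3 * \<xi> + \<psi>) / 3\<close> and
  \<open>(3 * \<xi> + \<psi>) / (6 * \<xi>)\<close>.\<close>

definition revenue :: "real \<Rightarrow> real \<Rightarrow> real" where
  "revenue \<xi> \<psi> =
     (if \<psi> \<le> - 3 * \<xi> then 0
      else if \<psi> < 3 * \<xi> then (3 * \<xi> + \<psi>)\<^sup>2 / (18 * \<xi>) else \<psi> - \<xi>)"

text \<open>A seller who cannot sell is indifferent, yet his price is determined: no sale means
  \<open>q \<le> - \<psi> - \<xi>\<close>, while the rival's best response satisfies
  \<open>q \<ge> - \<psi> + p - \<xi>\<close>, so \<open>p = 0\<close>.\<close>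

lemma mutual_best_response_iff:
  fixes \<xi> \<psi> p q :: real
  assumes "0 < \<xi>"
  shows "0 \<le> p \<and> 0 \<le> q \<and>
      (\<psi> + q + \<xi> \<le> 0 \<or> p = max ((\<psi> + q + \<xi>) / 2) (\<psi> + q - \<xi>)) \<and>
      (- \<psi> + p + \<xi> \<le> 0 \<or> q = max ((- \<psi> + p + \<xi>) / 2) (- \<psi> + p - \<xi>)) \<longleftrightarrow>
    p = eq_price \<xi> \<psi> \<and> q = eq_price \<xi> (- \<psi>)"
  using assms unfolding eq_price_def max_def by (auto split: if_splits)

lemma revenue_eq_price:
  assumes "0 < \<xi>"
  shows "eq_price \<xi> \<psi> * win_share \<xi> (\<psi> - eq_price \<xi> \<psi> + eq_price \<xi> (- \<psi>)) = revenue \<xi> \<psi>"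
  using assms
  by (auto simp: eq_price_def revenue_def win_share_def power2_eq_square field_simps)

lemma price_nash_distinct:
  assumes e: "0 < e" and "\<alpha> Seller1 \<noteq> \<alpha> Seller2"
  shows "price_nash Q c Q0 e \<alpha> p \<longleftrightarrow>
    p = (\<lambda>i. eq_price (e * \<bar>\<alpha> i - \<alpha> (rival i)\<bar>) (quality_gap Q Q0 \<alpha> i))"
proof -
  define \<xi> where "\<xi> = e * \<bar>\<alpha> Seller1 - \<alpha> Seller2\<bar>"
  define \<psi> where "\<psi> = quality_gap Q Q0 \<alpha> Seller1"
  have xi: "0 < \<xi>" using assms by (simp add: \<xi>_def)
  have xi2: "e * \<bar>\<alpha> Seller2 - \<alpha> Seller1\<bar> = \<xi>" by (simp add: \<xi>_def abs_minus_commute)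
  have gap2: "quality_gap Q Q0 \<alpha> Seller2 = - \<psi>"
    using quality_gap_rival[of Q Q0 \<alpha> Seller1] by (simp add: \<psi>_def)
  have all: "(\<forall>i. P i) \<longleftrightarrow> P Seller1 \<and> P Seller2" for P
    using all_seller_iff[of P Seller1] by simp
  have prof: "expected_profit Q c Q0 e \<alpha> p' Seller1
      = p' Seller1 * win_share \<xi> (\<psi> + p' Seller2 - p' Seller1) - c Seller1 * \<alpha> Seller1"
    "expected_profit Q c Q0 e \<alpha> p' Seller2
      = p' Seller2 * win_share \<xi> (- \<psi> + p' Seller1 - p' Seller2) - c Seller2 * \<alpha> Seller2" for p'
    using assms expected_profit_distinct[OF e, of \<alpha> Seller1 Q c Q0 p']
      expected_profit_distinct[OF e, of \<alpha> Seller2 Q c Q0 p']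
    by (simp_all add: xi2 gap2 \<xi>_def[symmetric] \<psi>_def[symmetric] algebra_simps)
  have "price_nash Q c Q0 e \<alpha> p \<longleftrightarrow>
     0 \<le> p Seller1 \<and> 0 \<le> p Seller2 \<and>
      (\<forall>q\<ge>0. q * win_share \<xi> (\<psi> + p Seller2 - q) \<le> p Seller1 * win_share \<xi> (\<psi> + p Seller2 - p Seller1)) \<and>
      (\<forall>q\<ge>0. q * win_share \<xi> (- \<psi> + p Seller1 - q) \<le> p Seller2 * win_share \<xi> (- \<psi> + p Seller1 - p Seller2))"
    unfolding price_nash_def all prof by auto
  also have "\<dots> \<longleftrightarrow> p Seller1 = eq_price \<xi> \<psi> \<and> p Seller2 = eq_price \<xi> (- \<psi>)"
    using best_response_iff[OF xi] mutual_best_response_iff[OF xi, of "p Seller1" "p Seller2" \<psi>]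
    by (smt (verit, ccfv_threshold))
  also have "\<dots> \<longleftrightarrow> p = (\<lambda>i. eq_price (e * \<bar>\<alpha> i - \<alpha> (rival i)\<bar>) (quality_gap Q Q0 \<alpha> i))"
    unfolding fun_eq_iff all by (simp add: xi2 gap2 \<xi>_def[symmetric] \<psi>_def[symmetric])
  finally show ?thesis .
qed

text \<open>Without disclosure the noise cancels and the sellers compete as in Bertrand's model.
  Undercutting by a factor above one half beats a tie, and the dearer seller sells nothing, so no
  positive price survives.\<close>

lemma price_nash_undisclosed:
  assumes e: "0 < e" and "\<alpha> Seller1 = 0" "\<alpha> Seller2 = 0"
  shows "price_nash Q c Q0 e \<alpha> p \<longleftrightarrow> p = (\<lambda>i. 0)"
proof -
  have prof: "expected_profit Q c Q0 e \<alpha> p i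
      = p i * (if p i < p (rival i) then 1 else if p i = p (rival i) then 1 / 2 else 0)" for p i
    using assms by (cases i) (auto simp: expected_profit_equal quality_gap_def)
  have "p = (\<lambda>i. 0)" if nash: "price_nash Q c Q0 e \<alpha> p"
  proof -
    have nn: "0 \<le> p i" for i using nash by (simp add: price_nash_def)
    \<comment> \<open>a positive price of the rival is undercut by three quarters of it\<close>
    have undercut: "3 / 4 * p (rival i)
        \<le> p i * (if p i < p (rival i) then 1 else if p i = p (rival i) then 1 / 2 else 0)"
      if "0 < p (rival i)" for i
    proof -
      have "expected_profit Q c Q0 e \<alpha> (p(i := 3 / 4 * p (rival i))) i \<le> expected_profit Q c Q0 e \<alpha> p i"
        using nash nn[of "rival i"] unfolding price_nash_def by auto
      then show ?thesis using that by (simp add: prof)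
    qed
    have "p i = 0" for i
    proof (rule ccontr)
      assume "p i \<noteq> 0"
      then have i: "0 < p i" using nn[of i] by simp
      then have *: "3 / 4 * p i
          \<le> p (rival i) * (if p (rival i) < p i then 1 else if p (rival i) = p i then 1 / 2 else 0)"
        using undercut[of "rival i"] unfolding rival_rival by simp
      with i have "0 < p (rival i)" using nn[of "rival i"] by (cases "p (rival i) = 0") auto
      from undercut[OF this] * i show False by (auto split: if_splits)
    qed
    then show ?thesis by auto
  qed
  moreover have "price_nash Q c Q0 e \<alpha> (\<lambda>i. 0)"
    unfolding price_nash_def by (auto simp: prof)
  ultimately show ?thesis by blast
qed


section \<open>Reduction of the payoffs to the revenue function\<close>

text \<open>Distinct levels and the undisclosed profile share one price formula, as
  \<open>eq_price\<close> vanishes at zero spread and zero gap.\<close>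

lemma pricing_equilibrium_iff:
  assumes "0 < e" "\<And>i. 0 \<le> \<alpha> i"
  shows "pricing_equilibrium Q c Q0 e \<alpha> p \<longleftrightarrow>
    \<not> (\<alpha> Seller1 = \<alpha> Seller2 \<and> 0 < \<alpha> Seller1) \<and>
    p = (\<lambda>i. eq_price (e * \<bar>\<alpha> i - \<alpha> (rival i)\<bar>) (quality_gap Q Q0 \<alpha> i))"
proof (cases "\<alpha> Seller1 = \<alpha> Seller2 \<and> \<alpha> Seller1 = 0")
  case True
  then have "\<alpha> i = 0" for i by (cases i) auto
  then show ?thesis
    using assms(1) price_nash_undisclosed[of e \<alpha>]
    by (simp add: pricing_equilibrium_def quality_gap_def eq_price_def)
next
  case False
  then have "\<alpha> Seller1 = \<alpha> Seller2 \<Longrightarrow> 0 < \<alpha> Seller1"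
    using assms(2)[of Seller1] by auto
  then show ?thesis
    using price_nash_distinct[OF assms(1), of \<alpha>] by (auto simp: pricing_equilibrium_def)
qed

lemma priceable_iff:
  assumes "0 < e" "\<And>i. 0 \<le> \<alpha> i"
  shows "priceable Q c Q0 e \<alpha> \<longleftrightarrow> (\<alpha> i = \<alpha> (rival i) \<longrightarrow> \<alpha> i = 0)"
  unfolding priceable_def pricing_equilibrium_iff[OF assms]
  using assms(2)[of Seller1] by (cases i) auto

lemma disclosure_payoff_eq:
  assumes e: "0 < e" and nonneg: "\<And>i. 0 \<le> \<alpha> i" and "priceable Q c Q0 e \<alpha>"
  shows "disclosure_payoff Q c Q0 e \<alpha> i =
    revenue (e * \<bar>\<alpha> i - \<alpha> (rival i)\<bar>) (quality_gap Q Q0 \<alpha> i) - c i * \<alpha> i"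
proof -
  let ?p = "\<lambda>i. eq_price (e * \<bar>\<alpha> i - \<alpha> (rival i)\<bar>) (quality_gap Q Q0 \<alpha> i)"
  have "\<not> (\<alpha> Seller1 = \<alpha> Seller2 \<and> 0 < \<alpha> Seller1)"
    using assms by (auto simp: priceable_iff[of _ _ _ _ _ Seller1])
  then have "disclosure_payoff Q c Q0 e \<alpha> = expected_profit Q c Q0 e \<alpha> ?p"
    using pricing_equilibrium_iff[OF e nonneg] by (simp add: disclosure_payoff_def)
  moreover have "expected_profit Q c Q0 e \<alpha> ?p i =
    revenue (e * \<bar>\<alpha> i - \<alpha> (rival i)\<bar>) (quality_gap Q Q0 \<alpha> i) - c i * \<alpha> i"
  proof (cases "\<alpha> i = \<alpha> (rival i)")
    case True
    then have "\<alpha> i = 0" "\<alpha> (rival i) = 0"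
      using assms by (auto simp: priceable_iff[of _ _ _ _ _ i])
    then show ?thesis
      using e by (simp add: expected_profit_equal quality_gap_def eq_price_def revenue_def)
  next
    case False
    then show ?thesis
      using e revenue_eq_price[of "e * \<bar>\<alpha> i - \<alpha> (rival i)\<bar>" "quality_gap Q Q0 \<alpha> i"]
      by (simp add: expected_profit_distinct quality_gap_rival abs_minus_commute)
  qed
  ultimately show ?thesis by simp
qed

section \<open>The disclosure game\<close>

lemma revenue_nonneg: "0 \<le> \<xi> \<Longrightarrow> 0 \<le> revenue \<xi> \<psi>"
  by (auto simp: revenue_def)

lemma revenue_pos: "0 < \<xi> \<Longrightarrow> - 3 * \<xi> < \<psi> \<Longrightarrow> 0 < revenue \<xi> \<psi>"
  by (auto simp: revenue_def)

lemma revenue_zero_spread: "revenue 0 \<psi> = max \<psi> 0"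
  by (simp add: revenue_def max_def)

text \<open>The branches and their thresholds are homogeneous of degree one. This makes a payoff
  linear in a level when the other level is zero.\<close>

lemma revenue_scale:
  assumes "0 \<le> d" "0 \<le> \<xi>"
  shows "revenue (d * \<xi>) (d * \<psi>) = d * revenue \<xi> \<psi>"
proof (cases "d = 0")
  case False
  then have d: "0 < d" using assms by simp
  have "d * \<psi> \<le> - 3 * (d * \<xi>) \<longleftrightarrow> \<psi> \<le> - 3 * \<xi>" "d * \<psi> < 3 * (d * \<xi>) \<longleftrightarrow> \<psi> < 3 * \<xi>"
    using mult_le_cancel_left_pos[OF d, of \<psi> "- 3 * \<xi>"] mult_less_cancel_left_pos[OF d, of \<psi> "3 * \<xi>"]
    by (simp_all add: algebra_simps)
  moreover have "(3 * (d * \<xi>) + d * \<psi>)\<^sup>2 / (18 * (d * \<xi>)) = d * ((3 * \<xi> + \<psi>)\<^sup>2 / (18 * \<xi>))"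
  proof -
    have "3 * (d * \<xi>) + d * \<psi> = d * (3 * \<xi> + \<psi>)" by (simp add: algebra_simps)
    then show ?thesis using d by (simp add: power2_eq_square)
  qed
  ultimately show ?thesis by (simp add: revenue_def algebra_simps)
qed (simp add: revenue_def)

text \<open>On the middle branch the difference of the two sides is
  \<open>(3 * \<xi> - \<psi>) * (9 * \<xi> - \<psi>)\<close> divided by
  \<open>18 * \<xi>\<close>.\<close>

lemma revenue_ge:
  assumes "0 \<le> \<xi>"
  shows "\<psi> - \<xi> \<le> revenue \<xi> \<psi>"
proof -
  have "\<psi> - \<xi> \<le> (3 * \<xi> + \<psi>)\<^sup>2 / (18 * \<xi>)" if "0 < \<xi>" "\<psi> < 3 * \<xi>"
  proof -
    have "0 \<le> (3 * \<xi> - \<psi>) * (9 * \<xi> - \<psi>)" using that by simp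
    then show ?thesis using that by (simp add: field_simps power2_eq_square)
  qed
  then show ?thesis using assms by (auto simp: revenue_def)
qed

text \<open>For positive \<xi> the branches join continuously, with slopes in \<psi> equal to 0,
  then rising from 0 to 2/3, then 1.\<close>

lemma revenue_mono_lipschitz:
  assumes xi: "0 \<le> \<xi>" and "\<psi> \<le> \<psi>'"
  shows "revenue \<xi> \<psi> \<le> revenue \<xi> \<psi>'" "revenue \<xi> \<psi>' \<le> revenue \<xi> \<psi> + (\<psi>' - \<psi>)"
proof -
  have "revenue \<xi> \<psi> \<le> revenue \<xi> \<psi>' \<and> revenue \<xi> \<psi>' \<le> revenue \<xi> \<psi> + (\<psi>' - \<psi>)"
  proof (cases "\<xi> = 0")
    case True
    then show ?thesis using assms by (auto simp: revenue_zero_spread max_def)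
  next
    case False
    then have xi: "0 < \<xi>" using assms by simp
    \<comment> \<open>the three branches in one: a quadratic in the truncated gap plus a linear part\<close>
    define t where "t x = max (- 3 * \<xi>) (min (3 * \<xi>) x)" for x
    have split: "revenue \<xi> x = (3 * \<xi> + t x)\<^sup>2 / (18 * \<xi>) + max 0 (x - 3 * \<xi>)" for x
      using xi by (auto simp: t_def revenue_def max_def min_def power2_eq_square field_simps)
    have t: "- 3 * \<xi> \<le> t \<psi>" "t \<psi> \<le> t \<psi>'" "t \<psi>' \<le> 3 * \<xi>"
      using assms xi by (auto simp: t_def max_def min_def)
    \<comment> \<open>The difference of the two squares factors as \<open>y * z\<close>; the bounds
      on \<open>z\<close> give monotonicity and the Lipschitz estimate.\<close>
    define y where "y = t \<psi>' - t \<psi>"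
    define z where "z = 6 * \<xi> + t \<psi>' + t \<psi>"
    have y: "0 \<le> y" "y + (max 0 (\<psi>' - 3 * \<xi>) - max 0 (\<psi> - 3 * \<xi>)) \<le> \<psi>' - \<psi>"
      using assms t xi by (auto simp: y_def t_def max_def min_def)
    have z: "0 \<le> z" "z \<le> 18 * \<xi>"
      using t xi unfolding z_def by linarith+
    have "(3 * \<xi> + t \<psi>')\<^sup>2 / (18 * \<xi>) - (3 * \<xi> + t \<psi>)\<^sup>2 / (18 * \<xi>) = y * (z / (18 * \<xi>))"
      using xi by (simp add: y_def z_def power2_eq_square field_simps)
    moreover have "0 \<le> y * (z / (18 * \<xi>))"
      using y(1) z xi by simp
    moreover have "y * (z / (18 * \<xi>)) \<le> y * 1"
      using y(1) z xi by (intro mult_left_mono) auto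
    moreover have "max 0 (\<psi> - 3 * \<xi>) \<le> max 0 (\<psi>' - 3 * \<xi>)"
      using assms by simp
    ultimately show ?thesis
      using y(2) unfolding split by linarith
  qed
  then show "revenue \<xi> \<psi> \<le> revenue \<xi> \<psi>'" "revenue \<xi> \<psi>' \<le> revenue \<xi> \<psi> + (\<psi>' - \<psi>)"
    by auto
qed

lemma revenue_add_le:
  assumes "0 \<le> \<xi>"
  shows "revenue \<xi> (\<psi> + \<eta>) \<le> revenue \<xi> \<psi> + max \<eta> 0"
  using revenue_mono_lipschitz[OF assms, of \<psi> "\<psi> + \<eta>"]
    revenue_mono_lipschitz[OF assms, of "\<psi> + \<eta>" \<psi>]
  by (cases "0 \<le> \<eta>") auto

section \<open>One-discloser profiles and chord bounds\<close>

text \<open>Keeps the treatment symmetric in the sellers. At level 0 it is the silent profile,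
  whichever seller is named.\<close>

definition solo :: "seller \<Rightarrow> real \<Rightarrow> seller \<Rightarrow> real" where
  "solo i a = (\<lambda>_. 0)(i := a)"

lemma solo_simps [simp]: "solo i a i = a" "solo i a (rival i) = 0" "solo (rival i) a i = 0"
  by (simp_all add: solo_def)

lemma profile_eq_solo: "profile a 0 = solo Seller1 a" "profile 0 a = solo Seller2 a"
  by (rule ext, case_tac x, simp_all add: solo_def)+

lemma eq_solo: "\<alpha> (rival i) = 0 \<Longrightarrow> \<alpha> = solo i (\<alpha> i)"
  by (simp add: seller_fun_eq_iff[of _ _ i])

text \<open>The qualities are not ordered here, so every result about \<open>i\<close> can also be
  applied to \<open>rival i\<close>.\<close>

locale disclosure_game =
  fixes Q c :: "seller \<Rightarrow> real" and Q0 e :: real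
  assumes e_pos: "0 < e" and cost_nonneg: "0 \<le> c i"
begin

abbreviation edge :: "seller \<Rightarrow> real" where
  "edge i \<equiv> Q i - Q0"

abbreviation equilibrium :: "(seller \<Rightarrow> real) \<Rightarrow> bool" where
  "equilibrium \<equiv> disclosure_equilibrium Q c Q0 e"

definition payoff :: "seller \<Rightarrow> real \<Rightarrow> real \<Rightarrow> real" where
  "payoff i a b = revenue (e * \<bar>a - b\<bar>) (a * edge i - b * edge (rival i)) - c i * a"

text \<open>The guard discards a deviation to the rival's level when that level is positive, as no
  pricing equilibrium exists there; joining a silent rival at 0 stays allowed.\<close>

definition best_reply :: "seller \<Rightarrow> real \<Rightarrow> real \<Rightarrow> bool" where
  "best_reply i a b \<longleftrightarrow> (\<forall>x\<in>{0..1}. (x = b \<longrightarrow> x = 0) \<longrightarrow> payoff i x b \<le> payoff i a b)"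

lemma equilibrium_iff:
  "equilibrium \<alpha> \<longleftrightarrow>
     \<alpha> i \<in> {0..1} \<and> \<alpha> (rival i) \<in> {0..1} \<and> (\<alpha> i = \<alpha> (rival i) \<longrightarrow> \<alpha> i = 0) \<and>
     best_reply i (\<alpha> i) (\<alpha> (rival i)) \<and> best_reply (rival i) (\<alpha> (rival i)) (\<alpha> i)"
proof (cases "(\<forall>j. \<alpha> j \<in> {0..1}) \<and> priceable Q c Q0 e \<alpha>")
  case True
  then have level: "\<And>j. 0 \<le> \<alpha> j" by simp
  have "(\<forall>a\<in>{0..1}. priceable Q c Q0 e (\<alpha>(j := a)) \<longrightarrow>
           disclosure_payoff Q c Q0 e (\<alpha>(j := a)) j \<le> disclosure_payoff Q c Q0 e \<alpha> j) \<longleftrightarrow>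
        best_reply j (\<alpha> j) (\<alpha> (rival j))" for j
  proof -
    have own: "disclosure_payoff Q c Q0 e \<alpha> j = payoff j (\<alpha> j) (\<alpha> (rival j))"
      using True level e_pos by (simp add: disclosure_payoff_eq payoff_def quality_gap_def)
    have dev: "priceable Q c Q0 e (\<alpha>(j := a)) \<longleftrightarrow> (a = \<alpha> (rival j) \<longrightarrow> a = 0)"
      "priceable Q c Q0 e (\<alpha>(j := a)) \<Longrightarrow>
        disclosure_payoff Q c Q0 e (\<alpha>(j := a)) j = payoff j a (\<alpha> (rival j))" if "a \<in> {0..1}" for a
    proof -
      have nn: "\<And>k. 0 \<le> (\<alpha>(j := a)) k" using level that by simp
      show "priceable Q c Q0 e (\<alpha>(j := a)) \<longleftrightarrow> (a = \<alpha> (rival j) \<longrightarrow> a = 0)"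
        using priceable_iff[where i = j and \<alpha> = "\<alpha>(j := a)", OF e_pos nn] by auto
      show "disclosure_payoff Q c Q0 e (\<alpha>(j := a)) j = payoff j a (\<alpha> (rival j))"
        if "priceable Q c Q0 e (\<alpha>(j := a))"
        using disclosure_payoff_eq[OF e_pos nn that, of j] by (simp add: payoff_def quality_gap_def)
    qed
    show ?thesis unfolding best_reply_def own using dev by auto
  qed
  then have "equilibrium \<alpha> \<longleftrightarrow> (\<forall>j. best_reply j (\<alpha> j) (\<alpha> (rival j)))"
    using True by (simp add: disclosure_equilibrium_def)
  then show ?thesis
    using True priceable_iff[where i = i and \<alpha> = \<alpha>, OF e_pos level]
    by (simp add: all_seller_iff[of _ i])
next
  case False
  then have "\<not> equilibrium \<alpha>" by (auto simp: disclosure_equilibrium_def)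
  moreover have "\<not> (\<alpha> i \<in> {0..1} \<and> \<alpha> (rival i) \<in> {0..1} \<and> (\<alpha> i = \<alpha> (rival i) \<longrightarrow> \<alpha> i = 0))"
  proof
    assume *: "\<alpha> i \<in> {0..1} \<and> \<alpha> (rival i) \<in> {0..1} \<and> (\<alpha> i = \<alpha> (rival i) \<longrightarrow> \<alpha> i = 0)"
    then have l: "\<forall>j. \<alpha> j \<in> {0..1}" by (subst all_seller_iff[of _ i]) simp
    then have "\<And>j. 0 \<le> \<alpha> j" by simp
    with * l False show False using priceable_iff[where i = i and \<alpha> = \<alpha>, OF e_pos] by auto
  qed
  ultimately show ?thesis by blast
qed

lemma payoff_zero_right: "0 \<le> a \<Longrightarrow> payoff i a 0 = a * (revenue e (edge i) - c i)"
  using revenue_scale[of a e "edge i"] e_pos by (simp add: payoff_def algebra_simps)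

lemma payoff_zero_left: "0 \<le> b \<Longrightarrow> payoff i 0 b = b * revenue e (- edge (rival i))"
  using revenue_scale[of b e "- edge (rival i)"] e_pos by (simp add: payoff_def algebra_simps)

text \<open>The gap splits into \<open>(b - a)\<close> times the gap at own level 0 and
  \<open>a\<close> times the quality difference. Homogeneity evaluates the first part, the Lipschitz
  bound absorbs the second. The bound is affine in \<open>a\<close> and exact at
  \<open>a = 0\<close>, so its slope decides whether silence is better.\<close>

lemma payoff_below_le:
  assumes "0 \<le> a" "a \<le> b"
  shows "payoff i a b \<le> b * revenue e (- edge (rival i))
    + a * (max (edge i - edge (rival i)) 0 - revenue e (- edge (rival i)) - c i)"
proof -
  have "revenue (e * \<bar>a - b\<bar>) (a * edge i - b * edge (rival i))
      = revenue ((b - a) * e) ((b - a) * (- edge (rival i)) + a * (edge i - edge (rival i)))"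
    using assms by (simp add: algebra_simps)
  also have "\<dots> \<le> revenue ((b - a) * e) ((b - a) * (- edge (rival i)))
      + max (a * (edge i - edge (rival i))) 0"
    using assms e_pos by (intro revenue_add_le) simp
  also have "max (a * (edge i - edge (rival i))) 0 = a * max (edge i - edge (rival i)) 0"
    using assms by (simp add: max_mult_distrib_left)
  finally show ?thesis
    using assms e_pos
    by (simp only: payoff_def revenue_scale[of "b - a" e] diff_ge_0_iff_ge less_imp_le)
      (simp add: algebra_simps)
qed

text \<open>Same splitting, now around a silent rival: \<open>(a - b)\<close> times the own edge
  plus \<open>b\<close> times the quality difference.\<close>

lemma payoff_above_le:
  assumes "0 \<le> b" "b \<le> a"
  shows "payoff i a b \<le>
    b * max (edge i - edge (rival i)) 0 + (a - b) * revenue e (edge i) - c i * a"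
proof -
  have "revenue (e * \<bar>a - b\<bar>) (a * edge i - b * edge (rival i))
      = revenue ((a - b) * e) ((a - b) * edge i + b * (edge i - edge (rival i)))"
    using assms by (simp add: algebra_simps)
  also have "\<dots> \<le> revenue ((a - b) * e) ((a - b) * edge i)
      + max (b * (edge i - edge (rival i))) 0"
    using assms e_pos by (intro revenue_add_le) simp
  also have "max (b * (edge i - edge (rival i))) 0 = b * max (edge i - edge (rival i)) 0"
    using assms by (simp add: max_mult_distrib_left)
  finally show ?thesis
    using assms e_pos
    by (simp only: payoff_def revenue_scale[of "a - b" e] diff_ge_0_iff_ge less_imp_le)
qed

text \<open>Where the truncation acts, the slope is minus a sum of nonnegative terms; elsewhere the
  assumption applies directly.\<close>

lemma max_edge_le:
  assumes "edge i - edge (rival i) - revenue e (- edge (rival i)) \<le> c i"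
  shows "max (edge i - edge (rival i)) 0 - revenue e (- edge (rival i)) - c i \<le> 0"
  using assms cost_nonneg[of i] revenue_nonneg[of e "- edge (rival i)"] e_pos by simp

lemma solo_equilibrium_iff:
  assumes "0 < a" "a \<le> 1"
  shows "equilibrium (solo i a) \<longleftrightarrow> best_reply i a 0 \<and> best_reply (rival i) 0 a"
  using assms by (simp add: equilibrium_iff[of _ i])

section \<open>Full disclosure by one seller\<close>

text \<open>The discloser's payoff is linear in his level, which gives the first condition. The
  second makes the rival's chord bound nonincreasing, and near level 1 that bound is attained
  closely enough to make it necessary.\<close>

lemma solo_one_equilibrium_iff:
  "equilibrium (solo i 1) \<longleftrightarrow>
     c i \<le> revenue e (edge i) \<and>
     edge (rival i) - edge i - revenue e (- edge i) \<le> c (rival i)" (is "_ \<longleftrightarrow> ?own \<and> ?other")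
proof
  assume "equilibrium (solo i 1)"
  then have br: "best_reply i 1 0" "best_reply (rival i) 0 1"
    by (simp_all add: solo_equilibrium_iff)
  have ?own
    using br(1)[unfolded best_reply_def, rule_format, of 0] by (simp add: payoff_zero_right)
  \<comment> \<open>Matching level 1 is not an admissible deviation, so the condition arises as the
    limit of deviations \<open>a < 1\<close>. Adding \<open>e\<close> on both sides leaves a left
    side proportional to \<open>a\<close>.\<close>
  moreover have "edge (rival i) + e - c (rival i) \<le> revenue e (- edge i) + edge i + e"
  proof (rule field_le_mult_one_interval)
    fix a :: real
    assume a: "0 < a" "a < 1"
    have "a * edge (rival i) - edge i - (1 - a) * e - c (rival i) * a \<le> payoff (rival i) a 1"
      using revenue_ge[of "(1 - a) * e" "a * edge (rival i) - edge i"] a e_pos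
      by (simp add: payoff_def mult.commute)
    also have "\<dots> \<le> payoff (rival i) 0 1"
      using br(2) a by (auto simp: best_reply_def)
    finally show "a * (edge (rival i) + e - c (rival i)) \<le> revenue e (- edge i) + edge i + e"
      by (simp add: payoff_zero_left algebra_simps)
  qed
  ultimately show "?own \<and> ?other" by simp
next
  assume cond: "?own \<and> ?other"
  have "best_reply i 1 0"
    unfolding best_reply_def using cond
    by (auto simp: payoff_zero_right intro!: mult_left_le_one_le)
  moreover have "best_reply (rival i) 0 1"
    unfolding best_reply_def
  proof (intro ballI impI)
    fix x :: real
    assume x: "x \<in> {0..1}"
    have "payoff (rival i) x 1 \<le> revenue e (- edge i)
        + x * (max (edge (rival i) - edge i) 0 - revenue e (- edge i) - c (rival i))"
      using payoff_below_le[of x 1 "rival i"] x by simp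
    also have "\<dots> \<le> revenue e (- edge i)"
      using max_edge_le[of "rival i"] cond x by (simp add: mult_le_0_iff)
    finally show "payoff (rival i) x 1 \<le> payoff (rival i) 0 1"
      by (simp add: payoff_zero_left)
  qed
  ultimately show "equilibrium (solo i 1)" by (simp add: solo_equilibrium_iff)
qed

lemma solo_zero_equilibrium:
  assumes "\<And>i. revenue e (edge i) \<le> c i"
  shows "equilibrium (solo i 0)"
proof -
  have "best_reply j 0 0" for j
    using assms[of j] by (auto simp: best_reply_def payoff_zero_right mult_le_0_iff)
  then show ?thesis by (simp add: equilibrium_iff[of _ i])
qed

text \<open>Against a silent rival the payoff is linear with positive slope, hence maximal only at
  1.\<close>

lemma solo_equilibrium_level:
  assumes "equilibrium (solo i a)" "c i < revenue e (edge i)"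
  shows "a = 1"
proof -
  have a: "0 \<le> a" "a \<le> 1" and "payoff i 1 0 \<le> payoff i a 0"
    using assms by (auto simp: equilibrium_iff[of _ i] best_reply_def)
  then have "1 * (revenue e (edge i) - c i) \<le> a * (revenue e (edge i) - c i)"
    by (simp add: payoff_zero_right)
  then have "1 \<le> a" using assms(2) by (simp only: mult_le_cancel_right_pos diff_gt_0_iff_gt)
  with a show ?thesis by simp
qed

section \<open>Silence forced by costs, and complete sets of equilibria\<close>

text \<open>The chord bound is strictly decreasing, so silence is strictly better;
  \<open>0 < c i\<close> provides strictness when the quality difference is truncated to 0.\<close>

lemma equilibrium_lower_level:
  assumes eq: "equilibrium \<alpha>" and less: "\<alpha> i < \<alpha> (rival i)"
    and c: "0 < c i" "edge i - edge (rival i) - revenue e (- edge (rival i)) < c i"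
  shows "\<alpha> i = 0"
proof (rule ccontr)
  assume "\<alpha> i \<noteq> 0"
  then have pos: "0 < \<alpha> i" and "payoff i 0 (\<alpha> (rival i)) \<le> payoff i (\<alpha> i) (\<alpha> (rival i))"
    using eq by (auto simp: equilibrium_iff[of _ i] best_reply_def)
  moreover have "\<alpha> i * (max (edge i - edge (rival i)) 0 - revenue e (- edge (rival i)) - c i) < 0"
    using pos c revenue_nonneg[of e "- edge (rival i)"] e_pos by (simp add: mult_less_0_iff)
  ultimately show False
    using payoff_below_le[of "\<alpha> i" "\<alpha> (rival i)" i] less by (simp add: payoff_zero_left)
qed

text \<open>Above the rival's level, revenue per unit of own level is at most the left side of the
  cost condition, so the payoff is negative, whereas silence never loses. Below the rival,
  \<open>equilibrium_lower_level\<close> applies.\<close>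

lemma equilibrium_costly:
  assumes eq: "equilibrium \<alpha>"
    and c: "max (edge i - edge (rival i)) 0 + revenue e (edge i) < c i"
  shows "\<alpha> i = 0"
proof (rule ccontr)
  assume nz: "\<alpha> i \<noteq> 0"
  have r: "0 \<le> revenue e x" for x using e_pos by (simp add: revenue_nonneg)
  show False
  proof (cases "\<alpha> i < \<alpha> (rival i)")
    case True
    have "\<alpha> i = 0"
      using c r[of "edge i"] r[of "- edge (rival i)"]
      by (intro equilibrium_lower_level[OF eq True]) (auto simp: max_def split: if_splits)
    with nz show False ..
  next
    case False
    define a b where "a = \<alpha> i" and "b = \<alpha> (rival i)"
    have ab: "0 < a" "0 \<le> b" "b < a" and "payoff i 0 b \<le> payoff i a b"
      using eq nz False by (auto simp: a_def b_def equilibrium_iff[of _ i] best_reply_def)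
    moreover have "0 \<le> b * revenue e (- edge (rival i))"
      using ab r by simp
    ultimately have "0 \<le> payoff i a b"
      by (simp add: payoff_zero_left)
    also have "\<dots> \<le> b * max (edge i - edge (rival i)) 0 + (a - b) * revenue e (edge i) - c i * a"
      using ab by (intro payoff_above_le) auto
    also have "\<dots> \<le> a * max (edge i - edge (rival i)) 0 + a * revenue e (edge i) - c i * a"
      using ab r[of "edge i"] by (intro diff_right_mono add_mono mult_right_mono) auto
    also have "\<dots> = a * (max (edge i - edge (rival i)) 0 + revenue e (edge i) - c i)"
      by (simp add: algebra_simps)
    also have "\<dots> < 0"
      using c ab by (simp add: mult_less_0_iff)
    finally show False by simp
  qed
qed

lemma equilibria_one_discloser:
  assumes "c i < revenue e (edge i)"
    and "max (edge (rival i) - edge i) 0 + revenue e (edge (rival i)) < c (rival i)"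
  shows "{\<alpha>. equilibrium \<alpha>} = {solo i 1}"
proof -
  have "0 \<le> revenue e x" for x using e_pos by (simp add: revenue_nonneg)
  from this[of "- edge i"] this[of "edge (rival i)"] have "equilibrium (solo i 1)"
    using assms by (simp add: solo_one_equilibrium_iff)
  moreover have "\<alpha> = solo i 1" if "equilibrium \<alpha>" for \<alpha>
  proof -
    have "\<alpha> = solo i (\<alpha> i)"
      using equilibrium_costly[OF that, of "rival i"] assms by (intro eq_solo) simp
    then show ?thesis using solo_equilibrium_level[of i "\<alpha> i"] assms that by metis
  qed
  ultimately show ?thesis by blast
qed

lemma equilibria_no_discloser:
  assumes "\<And>i. max (edge i - edge (rival i)) 0 + revenue e (edge i) < c i"
  shows "{\<alpha>. equilibrium \<alpha>} = {solo i 0}"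
proof -
  have "revenue e (edge i) \<le> c i" for i
    using assms[of i] by (simp add: max_def split: if_splits)
  then have "equilibrium (solo i 0)" by (rule solo_zero_equilibrium)
  moreover have "\<alpha> = solo i 0" if "equilibrium \<alpha>" for \<alpha>
    using equilibrium_costly[OF that assms] eq_solo[of \<alpha> i] by simp
  ultimately show ?thesis by blast
qed

text \<open>Levels in equilibrium differ unless both are zero, and the lower one is zero by
  \<open>equilibrium_lower_level\<close>. The other seller then discloses fully, which also excludes
  the silent profile.\<close>

lemma equilibria_either_discloser:
  assumes "\<And>i. 0 < c i" "\<And>i. c i < revenue e (edge i)"
    and "\<And>i. edge i - edge (rival i) - revenue e (- edge (rival i)) < c i"
  shows "{\<alpha>. equilibrium \<alpha>} = {solo i 1, solo (rival i) 1}"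
proof -
  have "equilibrium (solo j 1)" for j
    using assms(2)[of j] assms(3)[of "rival j"] by (simp add: solo_one_equilibrium_iff)
  moreover have "\<alpha> = solo i 1 \<or> \<alpha> = solo (rival i) 1" if eq: "equilibrium \<alpha>" for \<alpha>
  proof -
    have one: "\<alpha> = solo j 1" if "\<alpha> (rival j) = 0" for j
      using solo_equilibrium_level[of j "\<alpha> j"] assms(2)[of j] eq eq_solo[where i = j and \<alpha> = \<alpha>] that
      by metis
    have "\<alpha> i = 0 \<or> \<alpha> (rival i) = 0"
      using equilibrium_lower_level[OF eq _ assms(1) assms(3), of i]
        equilibrium_lower_level[OF eq _ assms(1) assms(3), of "rival i"] eq
      by (force simp: equilibrium_iff[of _ i])
    then show ?thesis using one[of i] one[of "rival i"] by auto
  qed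
  ultimately show ?thesis by blast
qed

section \<open>Equilibria at which the discloser is indifferent\<close>

text \<open>When \<open>c i\<close> equals the full-disclosure revenue, seller \<open>i\<close> is indifferent between all
  levels against a silent rival, so only the rival's deviations above \<open>a\<close> can destroy the
  equilibrium \<open>solo i a\<close>.\<close>

lemma indifferent_solo_equilibrium:
  assumes one: "equilibrium (solo i 1)" and c: "c i = revenue e (edge i)" and a: "0 < a" "a \<le> 1"
    and above: "\<And>x. a < x \<Longrightarrow> x \<le> 1 \<Longrightarrow> payoff (rival i) x a \<le> a * revenue e (- edge i)"
  shows "equilibrium (solo i a)"
proof -
  have "best_reply i a 0"
    using a c by (simp add: best_reply_def payoff_zero_right)
  moreover have "payoff (rival i) x a \<le> payoff (rival i) 0 a" if "0 \<le> x" "x \<le> 1" "x = a \<longrightarrow> x = 0" for x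
  proof (cases "a < x")
    case True
    then show ?thesis using above that a by (simp add: payoff_zero_left)
  next
    case False
    then have "payoff (rival i) x a \<le> a * revenue e (- edge i)
        + x * (max (edge (rival i) - edge i) 0 - revenue e (- edge i) - c (rival i))"
      using payoff_below_le[of x a "rival i"] that by simp
    also have "\<dots> \<le> a * revenue e (- edge i)"
      using max_edge_le[of "rival i"] one that by (simp add: solo_one_equilibrium_iff mult_le_0_iff)
    finally show ?thesis using a by (simp add: payoff_zero_left)
  qed
  then have "best_reply (rival i) 0 a" by (auto simp: best_reply_def)
  ultimately show ?thesis using a by (simp add: solo_equilibrium_iff)
qed

text \<open>Such a seller earns nothing by disclosing alone, so equilibrium at level 1 forces cost 0
  and makes him indifferent. If the rival is no better, he gains nothing from overbidding one half.
  A better rival is held back by his cost once the level is close to 1.\<close>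

lemma low_quality_not_isolated:
  assumes one: "equilibrium (solo i 1)" and low: "edge i \<le> - 3 * e"
  shows "\<exists>a. 0 < a \<and> a < 1 \<and> equilibrium (solo i a)"
proof -
  let ?A = "edge i" and ?B = "edge (rival i)" and ?d = "c (rival i)"
  have c: "c i = revenue e ?A"
    using one low cost_nonneg[of i] by (simp add: solo_one_equilibrium_iff revenue_def)
  have rev: "revenue e (- ?A) = - ?A - e"
    using low e_pos by (simp add: revenue_def)
  show ?thesis
  proof (cases "?B \<le> ?A")
    case True
    have "payoff (rival i) x (1 / 2) \<le> 1 / 2 * revenue e (- ?A)" if "1 / 2 < x" for x
    proof -
      have "revenue e ?B = 0" using True low by (simp add: revenue_def)
      then have "payoff (rival i) x (1 / 2) \<le> - (?d * x)"
        using payoff_above_le[of "1 / 2" x "rival i"] True that by simp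
      also have "\<dots> \<le> 0" using cost_nonneg that by simp
      finally show ?thesis using low e_pos unfolding rev by simp
    qed
    then show ?thesis
      using indifferent_solo_equilibrium[OF one c, of "1 / 2"] by (intro exI[of _ "1 / 2"]) simp
  next
    case False
    \<comment> \<open>so close to 1 that the rival, overbidding \<open>a\<close>, serves the whole market\<close>
    define a where "a = max (1 / 2) ((3 * e - ?B) / (3 * e - ?A))"
    have pos: "0 < 3 * e - ?A" using low e_pos by simp
    have a: "0 < a" "a < 1" using False pos by (auto simp: a_def)
    have "3 * e - ?B \<le> a * (3 * e - ?A)"
      using pos by (simp add: a_def pos_divide_le_eq[symmetric])
    then have one_end: "3 * e * (1 - a) \<le> ?B - a * ?A" by (simp add: algebra_simps)
    have d: "?B + e \<le> ?d"
      using one rev by (simp add: solo_one_equilibrium_iff)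
    have "payoff (rival i) x a \<le> a * revenue e (- ?A)" if x: "a < x" "x \<le> 1" for x
    proof -
      \<comment> \<open>An affine function of \<open>x\<close> interpolated between its nonnegative
        values at \<open>x = a\<close> and \<open>x = 1\<close>.\<close>
      have "(x * ?B - a * ?A - 3 * e * (x - a)) * (1 - a) =
          (x - a) * (?B - a * ?A - 3 * e * (1 - a)) + (1 - x) * (a * (?B - ?A))"
        by (simp add: algebra_simps)
      also have "0 \<le> \<dots>"
        using x a one_end False by (intro add_nonneg_nonneg mult_nonneg_nonneg) auto
      finally have "0 \<le> x * ?B - a * ?A - 3 * e * (x - a)"
        using a by (simp add: zero_le_mult_iff)
      then have "\<not> x * ?B - a * ?A < 3 * (e * (x - a))" by simp
      moreover have "0 < e * (x - a)" using e_pos x by simp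
      ultimately have "revenue (e * (x - a)) (x * ?B - a * ?A) = x * ?B - a * ?A - e * (x - a)"
        by (simp add: revenue_def)
      then have "payoff (rival i) x a = x * ?B - a * ?A - e * (x - a) - ?d * x"
        using x by (simp add: payoff_def)
      also have "\<dots> = x * (?B - e - ?d) + a * (e - ?A)" by (simp add: algebra_simps)
      also have "\<dots> \<le> x * (- 2 * e) + a * (e - ?A)"
        using d x a by (intro add_right_mono mult_left_mono) auto
      also have "\<dots> \<le> a * (- 2 * e) + a * (e - ?A)"
        using x e_pos by simp
      also have "\<dots> = a * revenue e (- ?A)" unfolding rev by (simp add: algebra_simps)
      finally show ?thesis .
    qed
    then show ?thesis
      using indifferent_solo_equilibrium[OF one c, of a] a by (intro exI[of _ a]) simp
  qed
qed

text \<open>The better seller can lower his level to some \<open>a < 1\<close> at which a rival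
  overbidding him still earns no revenue, so nothing tempts the rival out of silence.\<close>

lemma indifferent_high_quality_not_isolated:
  assumes one: "equilibrium (solo i 1)" and c: "c i = revenue e (edge i)"
    and B: "- 3 * e < edge (rival i)" "edge (rival i) < edge i"
  shows "\<exists>a. 0 < a \<and> a < 1 \<and> equilibrium (solo i a)"
proof -
  let ?A = "edge i" and ?B = "edge (rival i)"
  \<comment> \<open>the smallest level at which a rival disclosing fully wins no buyer at the equilibrium prices\<close>
  define a where "a = (?B + 3 * e) / (?A + 3 * e)"
  have a: "0 < a" "a < 1" using B by (simp_all add: a_def)
  have aeq: "a * (?A + 3 * e) = ?B + 3 * e" using B by (simp add: a_def)
  have "payoff (rival i) x a \<le> a * revenue e (- ?A)" if x: "a < x" "x \<le> 1" for x
  proof -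
    have "x * ?B - a * ?A + 3 * e * (x - a) = (x - 1) * (?B + 3 * e)"
      using aeq by (simp add: algebra_simps)
    also have "\<dots> \<le> 0" using x B by (simp add: mult_le_0_iff)
    finally have "revenue (e * (x - a)) (x * ?B - a * ?A) = 0"
      by (simp add: revenue_def)
    then have "payoff (rival i) x a = - (c (rival i) * x)"
      using x by (simp add: payoff_def)
    also have "\<dots> \<le> 0" using cost_nonneg x a by simp
    also have "0 \<le> a * revenue e (- ?A)" using a e_pos by (simp add: revenue_nonneg)
    finally show ?thesis .
  qed
  then show ?thesis
    using indifferent_solo_equilibrium[OF one c, of a] a by (intro exI[of _ a]) simp
qed

end

section \<open>Achievable patterns\<close>

lemma disclosure_game_profile:
  "0 < e \<Longrightarrow> 0 \<le> c1 \<Longrightarrow> 0 \<le> c2 \<Longrightarrow> disclosure_game (profile c1 c2) e"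
  by (intro disclosure_game.intro) (metis profile.simps seller.exhaust)+

lemma pattern_IV_achievable:
  assumes "0 < e"
  shows "Pattern_IV \<in> achievable_patterns Q0 e Q1 Q2"
proof -
  \<comment> \<open>Large enough to exceed the cost bound of \<open>equilibria_no_discloser\<close>
    for both sellers.\<close>
  define c where "c = \<bar>Q1 - Q2\<bar> + revenue e (Q1 - Q0) + revenue e (Q2 - Q0) + 1"
  have r: "0 \<le> revenue e x" for x using assms by (simp add: revenue_nonneg)
  have c: "0 \<le> c" using r[of "Q1 - Q0"] r[of "Q2 - Q0"] by (simp add: c_def)
  interpret disclosure_game "profile Q1 Q2" "profile c c" Q0 e
    using assms c by (intro disclosure_game_profile)
  have "{\<alpha>. equilibrium \<alpha>} = {solo Seller1 0}"
  proof (rule equilibria_no_discloser)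
    show "max (edge i - edge (rival i)) 0 + revenue e (edge i) < profile c c i" for i
      using r[of "Q1 - Q0"] r[of "Q2 - Q0"] by (cases i) (auto simp: c_def)
  qed
  then show ?thesis
    using c by (auto simp: achievable_patterns_def pattern_occurs_def profile_eq_solo)
qed

text \<open>Above the threshold, seller 1 discloses at no cost and with positive revenue while
  seller 2 is priced out. At or below it, \<open>(1, 0)\<close> is never an isolated
  equilibrium.\<close>

lemma pattern_I_achievable_iff:
  assumes "0 < e"
  shows "Pattern_I \<in> achievable_patterns Q0 e Q1 Q2 \<longleftrightarrow> Q0 - 3 * e < Q1"
proof
  assume "Pattern_I \<in> achievable_patterns Q0 e Q1 Q2"
  then obtain c1 c2 where c: "0 \<le> c1" "0 \<le> c2"
    and occ: "pattern_occurs (profile Q1 Q2) (profile c1 c2) Q0 e Pattern_I"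
    by (auto simp: achievable_patterns_def)
  interpret disclosure_game "profile Q1 Q2" "profile c1 c2" Q0 e
    using assms c by (intro disclosure_game_profile)
  have eq: "equilibrium \<alpha> \<longleftrightarrow> \<alpha> = solo Seller1 1" for \<alpha>
    using occ by (auto simp: pattern_occurs_def profile_eq_solo set_eq_iff)
  show "Q0 - 3 * e < Q1"
  proof (rule ccontr)
    assume "\<not> Q0 - 3 * e < Q1"
    then obtain a where "a < 1" "equilibrium (solo Seller1 a)"
      using low_quality_not_isolated[of Seller1] eq by auto
    then show False using eq by (metis less_irrefl solo_simps(1))
  qed
next
  assume Q1: "Q0 - 3 * e < Q1"
  define c where "c = \<bar>Q1 - Q2\<bar> + revenue e (Q2 - Q0) + 1"
  have r: "0 \<le> revenue e x" for x using assms by (simp add: revenue_nonneg)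
  have c: "0 \<le> c" using r[of "Q2 - Q0"] by (simp add: c_def)
  interpret disclosure_game "profile Q1 Q2" "profile 0 c" Q0 e
    using assms c by (intro disclosure_game_profile) auto
  have "{\<alpha>. equilibrium \<alpha>} = {solo Seller1 1}"
    using Q1 assms by (intro equilibria_one_discloser) (auto simp: c_def revenue_pos)
  then show "Pattern_I \<in> achievable_patterns Q0 e Q1 Q2"
    using c by (force simp: achievable_patterns_def pattern_occurs_def profile_eq_solo)
qed

lemma pattern_III_achievable_iff:
  assumes "0 < e"
  shows "Pattern_III \<in> achievable_patterns Q0 e Q1 Q2 \<longleftrightarrow> Q0 - 3 * e < Q2"
proof
  assume "Pattern_III \<in> achievable_patterns Q0 e Q1 Q2"
  then obtain c1 c2 where c: "0 \<le> c1" "0 \<le> c2"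
    and occ: "pattern_occurs (profile Q1 Q2) (profile c1 c2) Q0 e Pattern_III"
    by (auto simp: achievable_patterns_def)
  interpret disclosure_game "profile Q1 Q2" "profile c1 c2" Q0 e
    using assms c by (intro disclosure_game_profile)
  have eq: "equilibrium \<alpha> \<longleftrightarrow> \<alpha> = solo Seller2 1" for \<alpha>
    using occ by (auto simp: pattern_occurs_def profile_eq_solo set_eq_iff)
  show "Q0 - 3 * e < Q2"
  proof (rule ccontr)
    assume "\<not> Q0 - 3 * e < Q2"
    then obtain a where "a < 1" "equilibrium (solo Seller2 a)"
      using low_quality_not_isolated[of Seller2] eq by auto
    then show False using eq by (metis less_irrefl solo_simps(1))
  qed
next
  assume Q2: "Q0 - 3 * e < Q2"
  define c where "c = \<bar>Q1 - Q2\<bar> + revenue e (Q1 - Q0) + 1"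
  have r: "0 \<le> revenue e x" for x using assms by (simp add: revenue_nonneg)
  have c: "0 \<le> c" using r[of "Q1 - Q0"] by (simp add: c_def)
  interpret disclosure_game "profile Q1 Q2" "profile c 0" Q0 e
    using assms c by (intro disclosure_game_profile) auto
  have "{\<alpha>. equilibrium \<alpha>} = {solo Seller2 1}"
    using Q2 assms by (intro equilibria_one_discloser) (auto simp: c_def revenue_pos)
  then show "Pattern_III \<in> achievable_patterns Q0 e Q1 Q2"
    using c by (force simp: achievable_patterns_def pattern_occurs_def profile_eq_solo)
qed

text \<open>The two equilibria confine \<open>c1\<close> between the two sides of the last
  inequality. Strictness comes from isolation: at the upper end seller 1 is indifferent and further
  equilibria appear. For seller 2 the lower bound is nonpositive since \<open>Q2 \<le> Q1\<close>,
  so any small positive \<open>c2\<close> serves.\<close>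

lemma pattern_II_achievable_iff:
  assumes "0 < e" "Q2 \<le> Q1"
  shows "Pattern_II \<in> achievable_patterns Q0 e Q1 Q2 \<longleftrightarrow>
    Q0 - 3 * e < Q2 \<and> Q1 - Q2 - revenue e (Q0 - Q2) < revenue e (Q1 - Q0)"
proof
  assume "Pattern_II \<in> achievable_patterns Q0 e Q1 Q2"
  then obtain c1 c2 where c: "0 \<le> c1" "0 \<le> c2"
    and occ: "pattern_occurs (profile Q1 Q2) (profile c1 c2) Q0 e Pattern_II"
    by (auto simp: achievable_patterns_def)
  interpret disclosure_game "profile Q1 Q2" "profile c1 c2" Q0 e
    using assms c by (intro disclosure_game_profile)
  have eq: "equilibrium \<alpha> \<longleftrightarrow> \<alpha> = solo Seller1 1 \<or> \<alpha> = solo Seller2 1" for \<alpha>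
    using occ by (auto simp: pattern_occurs_def profile_eq_solo set_eq_iff)
  have isolated: "a = 1" if "equilibrium (solo i a)" "0 < a" for i a
    using that(1) unfolding eq seller_fun_eq_iff[of _ _ Seller1] using that(2)
    by (cases i) (auto simp: solo_def)
  have Q2: "Q0 - 3 * e < Q2"
  proof (rule ccontr)
    assume "\<not> Q0 - 3 * e < Q2"
    then obtain a where "0 < a" "a < 1" "equilibrium (solo Seller2 a)"
      using low_quality_not_isolated[of Seller2] eq by auto
    then show False using isolated[of Seller2 a] by simp
  qed
  have "c1 \<le> revenue e (Q1 - Q0)" "Q1 - Q2 - revenue e (Q0 - Q2) \<le> c1"
    using solo_one_equilibrium_iff[of Seller1] solo_one_equilibrium_iff[of Seller2] eq by auto
  \<comment> \<open>For equal qualities an indifferent \<open>c1\<close> is harmless: the left side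
    of the goal is then nonpositive and the right side positive.\<close>
  moreover have "Q1 = Q2" if indifferent: "c1 = revenue e (Q1 - Q0)"
  proof (rule ccontr)
    assume "Q1 \<noteq> Q2"
    moreover have "equilibrium (solo Seller1 1)" using eq by simp
    ultimately obtain a where "0 < a" "a < 1" "equilibrium (solo Seller1 a)"
      using indifferent_high_quality_not_isolated[of Seller1] indifferent Q2 assms(2) by auto
    then show False using isolated[of Seller1 a] by simp
  qed
  moreover have "0 \<le> revenue e (Q0 - Q2)" "Q1 = Q2 \<Longrightarrow> 0 < revenue e (Q1 - Q0)"
    using assms Q2 by (simp_all add: revenue_nonneg revenue_pos)
  ultimately show "Q0 - 3 * e < Q2 \<and> Q1 - Q2 - revenue e (Q0 - Q2) < revenue e (Q1 - Q0)"
    using Q2 by linarith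
next
  assume *: "Q0 - 3 * e < Q2 \<and> Q1 - Q2 - revenue e (Q0 - Q2) < revenue e (Q1 - Q0)"
  have pos: "0 < revenue e (Q1 - Q0)" "0 < revenue e (Q2 - Q0)"
    using * assms by (simp_all add: revenue_pos)
  with * have "max 0 (Q1 - Q2 - revenue e (Q0 - Q2)) < revenue e (Q1 - Q0)" by simp
  then obtain c1 where c1: "max 0 (Q1 - Q2 - revenue e (Q0 - Q2)) < c1" "c1 < revenue e (Q1 - Q0)"
    using dense by blast
  obtain c2 where c2: "0 < c2" "c2 < revenue e (Q2 - Q0)"
    using dense pos(2) by blast
  interpret disclosure_game "profile Q1 Q2" "profile c1 c2" Q0 e
    using assms c1 c2 by (intro disclosure_game_profile) auto
  have r: "0 \<le> revenue e (Q0 - Q1)" using assms by (simp add: revenue_nonneg)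
  have "{\<alpha>. equilibrium \<alpha>} = {solo Seller1 1, solo (rival Seller1) 1}"
  proof (rule equilibria_either_discloser)
    show "0 < profile c1 c2 i" "profile c1 c2 i < revenue e (edge i)"
      "edge i - edge (rival i) - revenue e (- edge (rival i)) < profile c1 c2 i" for i
      using c1 c2 r assms(2) by (cases i; simp)+
  qed
  then have "pattern_occurs (profile Q1 Q2) (profile c1 c2) Q0 e Pattern_II"
    by (simp add: pattern_occurs_def profile_eq_solo)
  moreover have "0 \<le> c1" "0 \<le> c2" using c1 c2 by auto
  ultimately show "Pattern_II \<in> achievable_patterns Q0 e Q1 Q2"
    unfolding achievable_patterns_def by blast
qed

section \<open>Algebra of the mixed threshold\<close>

text \<open>For \<open>A < 3 * e\<close>, clearing the denominator \<open>18 * e\<close> and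
  completing squares gives the exterior of the circle
  \<open>(A - 6 * e)\<^sup>2 + (B + 6 * e)\<^sup>2 = 54 * e\<^sup>2\<close>. For larger
  \<open>A\<close> the condition no longer depends on \<open>A\<close>, and the threshold is
  constant.\<close>

lemma mixed_threshold_less_iff:
  assumes e: "0 < e" and Q: "Q0 - 3 * e < Q2" "Q2 \<le> Q1"
  shows "Q1 - Q2 - revenue e (Q0 - Q2) < revenue e (Q1 - Q0) \<longleftrightarrow> mixed_threshold Q0 e Q1 < Q2"
proof -
  define A B where "A = Q1 - Q0" and "B = Q2 - Q0"
  have AB: "- 3 * e < B" "B \<le> A" using Q by (simp_all add: A_def B_def)
  \<comment> \<open>Here \<open>B + 6 * e\<close> is positive, and \<open>sqrt\<close> is strictly
    increasing on all reals, so the radicand \<open>s\<close> may be negative.\<close>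
  have root: "sqrt s < B + 6 * e \<longleftrightarrow> s < (B + 6 * e)\<^sup>2" for s
    using real_sqrt_less_iff[of s "(B + 6 * e)\<^sup>2"] AB e by simp
  have "A - B - revenue e (- B) < revenue e A \<longleftrightarrow>
      (if A < 3 * e then sqrt (54 * e\<^sup>2 - (A - 6 * e)\<^sup>2) else 3 * sqrt 5 * e) < B + 6 * e"
  proof (cases "A < 3 * e")
    case True
    have "(54 * e\<^sup>2 - (A - 6 * e)\<^sup>2 < (B + 6 * e)\<^sup>2) \<longleftrightarrow>
        18 * e * (A - B) < (3 * e - B)\<^sup>2 + (3 * e + A)\<^sup>2"
      by (simp add: power2_eq_square algebra_simps)
    also have "\<dots> \<longleftrightarrow> A - B < ((3 * e - B)\<^sup>2 + (3 * e + A)\<^sup>2) / (18 * e)"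
      using e by (simp add: pos_less_divide_eq mult.commute)
    finally show ?thesis
      using True AB e by (simp add: root revenue_def add_divide_distrib) linarith
  next
    case A: False
    have sqrt45: "3 * sqrt 5 * e = sqrt (45 * e\<^sup>2)"
      using e by (intro real_sqrt_unique[symmetric]) (simp_all add: power_mult_distrib)
    show ?thesis
    proof (cases "B < 3 * e")
      case True
      have "(45 * e\<^sup>2 < (B + 6 * e)\<^sup>2) \<longleftrightarrow> 18 * e * (e - B) < (3 * e - B)\<^sup>2"
        by (simp add: power2_eq_square algebra_simps)
      also have "\<dots> \<longleftrightarrow> e - B < (3 * e - B)\<^sup>2 / (18 * e)"
        using e by (simp add: pos_less_divide_eq mult.commute)
      finally show ?thesis
        using A True AB e by (simp add: sqrt45 root revenue_def) linarith
    next
      case False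
      have "sqrt 5 < 3" by (rule real_less_lsqrt) auto
      then have "sqrt 5 * e < 3 * e" using e by simp
      then have "3 * sqrt 5 * e < B + 6 * e" using False by linarith
      then show ?thesis using A False e by (simp add: revenue_def)
    qed
  qed
  then show ?thesis
    by (auto simp: A_def B_def mixed_threshold_def algebra_simps split: if_splits)
qed

text \<open>Locates where the threshold curve crosses the line \<open>Q2 = Q0 - 3 * e\<close>: on
  the circle this means \<open>(Q1 - Q0 - 6 * e)\<^sup>2 = 45 * e\<^sup>2\<close>.\<close>

lemma mixed_threshold_ge_iff:
  assumes e: "0 < e"
  shows "Q0 - 3 * e < mixed_threshold Q0 e Q1 \<longleftrightarrow> Q0 + (6 - 3 * sqrt 5) * e < Q1"
    and "Q0 - 3 * e \<le> mixed_threshold Q0 e Q1 \<longleftrightarrow> Q0 + (6 - 3 * sqrt 5) * e \<le> Q1"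
proof -
  have 5: "e < sqrt 5 * e" using e by simp
  have sq: "(3 * sqrt 5 * e)\<^sup>2 = 45 * e\<^sup>2" "(3 * e)\<^sup>2 = 9 * e\<^sup>2"
    by (simp_all add: power_mult_distrib)
  have "(Q0 - 3 * e < mixed_threshold Q0 e Q1 \<longleftrightarrow> Q0 + (6 - 3 * sqrt 5) * e < Q1) \<and>
    (Q0 - 3 * e \<le> mixed_threshold Q0 e Q1 \<longleftrightarrow> Q0 + (6 - 3 * sqrt 5) * e \<le> Q1)"
  proof (cases "Q1 < Q0 + 3 * e")
    case True
    let ?s = "54 * e\<^sup>2 - (Q1 - Q0 - 6 * e)\<^sup>2"
    \<comment> \<open>The reversed base is nonnegative for \<open>Q1 < Q0 + 3 * e\<close>, so
      squares can be compared through their bases.\<close>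
    have flip: "(Q1 - Q0 - 6 * e)\<^sup>2 = (6 * e - (Q1 - Q0))\<^sup>2"
      by (simp add: power2_commute)
    have "sqrt ((3 * e)\<^sup>2) = 3 * e" using e by (simp only: real_sqrt_abs)
    then have "3 * e < sqrt ?s \<longleftrightarrow> (3 * e)\<^sup>2 < ?s" "3 * e \<le> sqrt ?s \<longleftrightarrow> (3 * e)\<^sup>2 \<le> ?s"
      using real_sqrt_less_iff[of "(3 * e)\<^sup>2" ?s] real_sqrt_le_iff[of "(3 * e)\<^sup>2" ?s] by simp_all
    moreover have "(3 * e)\<^sup>2 < ?s \<longleftrightarrow> (6 * e - (Q1 - Q0))\<^sup>2 < (3 * sqrt 5 * e)\<^sup>2"
      "(3 * e)\<^sup>2 \<le> ?s \<longleftrightarrow> (6 * e - (Q1 - Q0))\<^sup>2 \<le> (3 * sqrt 5 * e)\<^sup>2"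
      unfolding sq flip by auto
    moreover have nonneg: "0 \<le> 6 * e - (Q1 - Q0)" "0 \<le> 3 * sqrt 5 * e"
      using True e by auto
    have "(6 * e - (Q1 - Q0))\<^sup>2 < (3 * sqrt 5 * e)\<^sup>2 \<longleftrightarrow> 6 * e - (Q1 - Q0) < 3 * sqrt 5 * e"
      "(6 * e - (Q1 - Q0))\<^sup>2 \<le> (3 * sqrt 5 * e)\<^sup>2 \<longleftrightarrow> 6 * e - (Q1 - Q0) \<le> 3 * sqrt 5 * e"
      using power_mono_iff[OF nonneg, of 2] power_mono_iff[OF nonneg(2) nonneg(1), of 2]
      by (simp_all only: not_le[symmetric] zero_less_numeral simp_thms)
    ultimately show ?thesis
      using True by (auto simp: mixed_threshold_def algebra_simps)
  next
    case False
    then show ?thesis using 5 by (auto simp: mixed_threshold_def algebra_simps)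
  qed
  then show "Q0 - 3 * e < mixed_threshold Q0 e Q1 \<longleftrightarrow> Q0 + (6 - 3 * sqrt 5) * e < Q1"
    and "Q0 - 3 * e \<le> mixed_threshold Q0 e Q1 \<longleftrightarrow> Q0 + (6 - 3 * sqrt 5) * e \<le> Q1"
    by auto
qed

section \<open>The regions of quality pairs\<close>

text \<open>Exact on boundaries too, so what remains is to compare each region with the lines
  \<open>Q0 - 3 * e\<close> and the mixed threshold.\<close>

lemma achievable_patterns_eq:
  assumes "0 < e" "Q2 \<le> Q1"
  shows "achievable_patterns Q0 e Q1 Q2 =
    {Pattern_IV} \<union>
    (if Q0 - 3 * e < Q1 then {Pattern_I} else {}) \<union>
    (if Q0 - 3 * e < Q2 then {Pattern_III} else {}) \<union>
    (if Q0 - 3 * e < Q2 \<and> mixed_threshold Q0 e Q1 < Q2 then {Pattern_II} else {})"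
    (is "?L = ?R")
proof (rule set_eqI)
  show "P \<in> ?L \<longleftrightarrow> P \<in> ?R" for P
    using assms mixed_threshold_less_iff[of e Q0 Q2 Q1]
    by (cases P) (auto simp: pattern_I_achievable_iff pattern_II_achievable_iff
        pattern_III_achievable_iff pattern_IV_achievable)
qed

theorem theorem1:
  fixes Q0 \<epsilon>0 Q1 Q2 :: real
  assumes "Q0 > 0" "0 < \<epsilon>0" "\<epsilon>0 \<le> Q0 / 3" "Q1 \<ge> Q2" "Q2 \<ge> 0"
  shows
    "((Q1, Q2) \<in> all_region Q0 \<epsilon>0 - (disclosure_boundary Q0 \<epsilon>0 \<union> mixed_boundary Q0 \<epsilon>0) \<longrightarrow>
        achievable_patterns Q0 \<epsilon>0 Q1 Q2 = {Pattern_I, Pattern_II, Pattern_III, Pattern_IV}) \<and>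
     ((Q1, Q2) \<in> no_mixed_region Q0 \<epsilon>0 - disclosure_boundary Q0 \<epsilon>0 \<longrightarrow>
        achievable_patterns Q0 \<epsilon>0 Q1 Q2 = {Pattern_I, Pattern_III, Pattern_IV}) \<and>
     (0 \<le> Q2 \<and> Q2 < Q0 - 3 * \<epsilon>0 \<and> Q0 - 3 * \<epsilon>0 < Q1 \<longrightarrow>
        achievable_patterns Q0 \<epsilon>0 Q1 Q2 = {Pattern_I, Pattern_IV}) \<and>
     (0 \<le> Q2 \<and> Q2 < Q1 \<and> Q1 < Q0 - 3 * \<epsilon>0 \<longrightarrow>
        achievable_patterns Q0 \<epsilon>0 Q1 Q2 = {Pattern_IV}) \<and>
     ((Q1, Q2) \<in> mixed_boundary Q0 \<epsilon>0 \<longrightarrow>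
        achievable_patterns Q0 \<epsilon>0 Q1 Q2 = {Pattern_I, Pattern_III, Pattern_IV}) \<and>
     ((Q1, Q2) \<in> disclosure_boundary Q0 \<epsilon>0 \<longrightarrow>
        achievable_patterns Q0 \<epsilon>0 Q1 Q2 =
          (if Q1 = Q0 - 3 * \<epsilon>0 then {Pattern_IV} else {Pattern_I, Pattern_IV}))"
proof -
  note ach = achievable_patterns_eq[OF assms(2) assms(4), of Q0]
  note thr = mixed_threshold_ge_iff[OF assms(2), of Q0 Q1]
  \<comment> \<open>The weak upper bound lets this serve both the no-mixed region and the mixed
    boundary.\<close>
  have no_mixed: "achievable_patterns Q0 \<epsilon>0 Q1 Q2 = {Pattern_I, Pattern_III, Pattern_IV}"
    if "Q0 - 3 * \<epsilon>0 < Q2" "Q2 \<le> mixed_threshold Q0 \<epsilon>0 Q1"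
    using that assms(4) unfolding ach by auto
  have "achievable_patterns Q0 \<epsilon>0 Q1 Q2 = {Pattern_I, Pattern_II, Pattern_III, Pattern_IV}"
    if "(Q1, Q2) \<in> all_region Q0 \<epsilon>0 - (disclosure_boundary Q0 \<epsilon>0 \<union> mixed_boundary Q0 \<epsilon>0)"
  proof -
    have "1 * \<epsilon>0 \<le> sqrt 5 * \<epsilon>0" using assms(2) by (intro mult_right_mono) auto
    then have "Q0 + (6 - 3 * sqrt 5) * \<epsilon>0 \<le> Q0 + 3 * \<epsilon>0" by (simp add: algebra_simps)
    then have "Q0 - 3 * \<epsilon>0 \<le> Q2"
      using that thr(2) by (auto simp: all_region_def)
    moreover have "Q2 \<noteq> Q0 - 3 * \<epsilon>0"
      using that by (simp add: disclosure_boundary_def)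
    ultimately have Q2: "Q0 - 3 * \<epsilon>0 < Q2" by simp
    have "mixed_threshold Q0 \<epsilon>0 Q1 < Q2"
    \<comment> \<open>Right of the crossing point, exclusion of the mixed boundary makes the
      inequality strict; elsewhere the threshold is at most \<open>Q0 - 3 * \<epsilon>0\<close>,
      which lies below \<open>Q2\<close>.\<close>
    proof (cases "Q0 + (6 - 3 * sqrt 5) * \<epsilon>0 < Q1")
      case True
      then show ?thesis using that by (auto simp: all_region_def mixed_boundary_def)
    next
      case False
      then show ?thesis using thr Q2 by linarith
    qed
    with Q2 show ?thesis using assms(4) unfolding ach by auto
  qed
  moreover have "achievable_patterns Q0 \<epsilon>0 Q1 Q2 = {Pattern_I, Pattern_III, Pattern_IV}"
    if "(Q1, Q2) \<in> no_mixed_region Q0 \<epsilon>0 - disclosure_boundary Q0 \<epsilon>0"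
    using that by (intro no_mixed) (auto simp: no_mixed_region_def disclosure_boundary_def)
  moreover have "achievable_patterns Q0 \<epsilon>0 Q1 Q2 = {Pattern_I, Pattern_III, Pattern_IV}"
    if "(Q1, Q2) \<in> mixed_boundary Q0 \<epsilon>0"
    using that thr by (intro no_mixed) (auto simp: mixed_boundary_def)
  moreover have "achievable_patterns Q0 \<epsilon>0 Q1 Q2 =
      (if Q1 = Q0 - 3 * \<epsilon>0 then {Pattern_IV} else {Pattern_I, Pattern_IV})"
    if "(Q1, Q2) \<in> disclosure_boundary Q0 \<epsilon>0"
    using that assms(4) unfolding ach disclosure_boundary_def by auto
  moreover have "achievable_patterns Q0 \<epsilon>0 Q1 Q2 = {Pattern_I, Pattern_IV}"
    if "Q2 < Q0 - 3 * \<epsilon>0" "Q0 - 3 * \<epsilon>0 < Q1"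
    using that unfolding ach by auto
  moreover have "achievable_patterns Q0 \<epsilon>0 Q1 Q2 = {Pattern_IV}"
    if "Q2 < Q1" "Q1 < Q0 - 3 * \<epsilon>0"
    using that unfolding ach by auto
  ultimately show ?thesis by blast
qed

end
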